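(* Suppose that the inflow rate $u$ is piecewise constant, i.e., there is an increasing sequence $(\xi_k)_{k\in\mathbb{N}}$ with $\xi_0=0$ and $\xi_k\to\infty$ such that $u$ is constant on each interval $[\xi_k,\xi_{k+1})$ (and $u=0$ on $(-\infty,0)$). Then the earliest-time functions $(\ell_v)_{v\in V}$ are the same for all dynamic equilibria $f=(f^+,f^-)$ which are right-continuous (i.e. every $f_e^+$ and $f_e^-$, $e\in E$, is right-continuous on $\mathbb R$).
   Context: Network. $G=(V,E)$ is a finite directed graph without loops and with at most one edge from $v$ to $w$ for every pair of nodes; an edge from $v$ to $w$ is written $e=vw$, and $\delta^+(v),\delta^-(v)$ are the sets of edges leaving and entering $v$. Each edge has a service rate $\nu_e>0$ and a travel time $\tau_e\ge 0$. There are a source $s$ and a sink $t\neq s$; every node is reachable from $s$ by a directed path; and $\sum_{e\in C}\tau_e>0$ for every directed cycle $C$. $\mathcal F_0(\mathbb R)$ is the set of nonnegative locally integrable functions on $\mathbb R$ that vanish a.e. on $(-\infty,0)$. The inflow rate is $u\in\mathcal F_0(\mathbb R)$. Flows over time. A flow-over-time is a pair $f=(f^+,f^-)$ of arrays of functions $f_e^+,f_e^-\in\mathcal F_0(\mathbb R)$, $e\in E$. Put $F_e^\pm(\theta)=\int_0^\theta f_e^\pm(\xi)\,d\xi$ and $z_e(\theta)=F_e^+(\theta)-F_e^-(\theta+\tau_e)$ (queue size). $f$ is feasible if for almost all $\theta$: $f_e^-(\theta)\le\nu_e$ and $z_e(\theta)\ge0$ for each $e$, and $\sum_{e\in\delta^+(v)}f_e^+(\theta)-\sum_{e\in\delta^-(v)}f_e^-(\theta)$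 equals $u(\theta)$ for $v=s$ and $0$ for $v\in V\setminus\{s,t\}$. It is always assumed that queues operate at capacity: for each $e$ and almost all $\theta$, $f_e^-(\theta+\tau_e)=\nu_e$ if $z_e(\theta)>0$ and $f_e^-(\theta+\tau_e)=\min\{f_e^+(\theta),\nu_e\}$ otherwise. Travel times. $T_e(\theta)=\theta+z_e(\theta)/\nu_e+\tau_e$. For a directed path $P=(e_1,\dots,e_k)$, $\ell^P(\theta)=T_{e_k}\circ\cdots\circ T_{e_1}(\theta)$. The earliest-time functions (depending on $f$) are $\ell_w(\theta)=\min_{P}\ell^P(\theta)$ over all directed $s$-$w$ paths $P$, with $\ell_s(\theta)=\theta$. An edge $e=vw$ is active at $\theta$ if $T_e(\ell_v(\theta))\le\ell_w(\theta)$ (equivalently, equality holds); $\Theta_e$ is the set of all $\theta\in\mathbb R$ at which $e$ is active. Equilibrium. A feasible flow-over-time $f$ is a dynamic equilibrium if for each $e=vw\in E$ we have $f_e^+(\xi)=0$ for almost all $\xi\in\ell_v(\mathbb R\setminus\Theta_e)$. *)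

theory Defs
  imports "HOL-Analysis.Analysis" "Graph_Theory.Arc_Walk"
begin

text \<open>The class of nonnegative locally integrable functions on the reals that vanish almost
  everywhere on the negative half-line.\<close>

definition F0 :: "(real \<Rightarrow> real) set" where
  "F0 = {f. (\<forall>\<theta>. 0 \<le> f \<theta>) \<and>
            (\<forall>a b. set_integrable lebesgue {a..b} f) \<and>
            (AE \<theta> in lebesgue. \<theta> < 0 \<longrightarrow> f \<theta> = 0)}"

text \<open>A flow over time is a pair of families of edge inflow rates (first component) and edge
  outflow rates (second component). Only the values on the edges of the graph at hand matter.\<close>

type_synonym 'e flow = "('e \<Rightarrow> real \<Rightarrow> real) \<times> ('e \<Rightarrow> real \<Rightarrow> real)"

definition cumulative :: "(real \<Rightarrow> real) \<Rightarrow> real \<Rightarrow> real" where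
  "cumulative g \<theta> = interval_lebesgue_integral lebesgue 0 (ereal \<theta>) g"

locale flow_network = digraph G
  for G :: "('v, 'e) pre_digraph" (structure) +
  fixes \<nu> \<tau> :: "'e \<Rightarrow> real" and s t :: 'v
  assumes service_rate_pos: "e \<in> arcs G \<Longrightarrow> 0 < \<nu> e"
    and travel_time_nonneg: "e \<in> arcs G \<Longrightarrow> 0 \<le> \<tau> e"
    and source_in_verts: "s \<in> verts G"
    and sink_in_verts: "t \<in> verts G"
    and sink_neq_source: "t \<noteq> s"
    and reachable_from_source: "v \<in> verts G \<Longrightarrow> s \<rightarrow>\<^sup>* v"
    and cycle_travel_time_pos: "cycle C \<Longrightarrow> 0 < (\<Sum>e\<in>set C. \<tau> e)"
begin

definition queue :: "'e flow \<Rightarrow> 'e \<Rightarrow> real \<Rightarrow> real" where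
  "queue f e \<theta> = cumulative (fst f e) \<theta> - cumulative (snd f e) (\<theta> + \<tau> e)"

definition feasible :: "(real \<Rightarrow> real) \<Rightarrow> 'e flow \<Rightarrow> bool" where
  "feasible u f \<longleftrightarrow>
     (AE \<theta> in lebesgue.
        (\<forall>e\<in>arcs G. snd f e \<theta> \<le> \<nu> e \<and> 0 \<le> queue f e \<theta>) \<and>
        (\<forall>v\<in>verts G - {t}.
           (\<Sum>e\<in>out_arcs G v. fst f e \<theta>) - (\<Sum>e\<in>in_arcs G v. snd f e \<theta>)
             = (if v = s then u \<theta> else 0)))"

definition queues_at_capacity :: "'e flow \<Rightarrow> bool" where
  "queues_at_capacity f \<longleftrightarrow>
     (\<forall>e\<in>arcs G. AE \<theta> in lebesgue.
        snd f e (\<theta> + \<tau> e) = (if 0 < queue f e \<theta> then \<nu> e else min (fst f e \<theta>) (\<nu> e)))"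

definition feasible_flow_over_time :: "(real \<Rightarrow> real) \<Rightarrow> 'e flow \<Rightarrow> bool" where
  "feasible_flow_over_time u f \<longleftrightarrow>
     (\<forall>e\<in>arcs G. fst f e \<in> F0 \<and> snd f e \<in> F0) \<and> feasible u f \<and> queues_at_capacity f"

definition exit_time :: "'e flow \<Rightarrow> 'e \<Rightarrow> real \<Rightarrow> real" where
  "exit_time f e \<theta> = \<theta> + queue f e \<theta> / \<nu> e + \<tau> e"

text \<open>The first edge of the path is applied first, and the empty path yields the identity.\<close>

definition path_arrival :: "'e flow \<Rightarrow> 'e awalk \<Rightarrow> real \<Rightarrow> real" where
  "path_arrival f P = fold (exit_time f) P"

text \<open>The minimum ranges over a finite nonempty set. For the source itself, the empty path is
  the only path, so the value there is the identity.\<close>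

definition earliest_time :: "'e flow \<Rightarrow> 'v \<Rightarrow> real \<Rightarrow> real" where
  "earliest_time f w \<theta> = Min ((\<lambda>P. path_arrival f P \<theta>) ` {P. apath s P w})"

definition active_times :: "'e flow \<Rightarrow> 'e \<Rightarrow> real set" where
  "active_times f e =
     {\<theta>. exit_time f e (earliest_time f (tail G e) \<theta>) \<le> earliest_time f (head G e) \<theta>}"

definition dynamic_equilibrium :: "(real \<Rightarrow> real) \<Rightarrow> 'e flow \<Rightarrow> bool" where
  "dynamic_equilibrium u f \<longleftrightarrow>
     feasible_flow_over_time u f \<and>
     (\<forall>e\<in>arcs G. AE \<xi> in lebesgue.
        \<xi> \<in> earliest_time f (tail G e) ` (UNIV - active_times f e) \<longrightarrow> fst f e \<xi> = 0)"

definition right_continuous_flow :: "'e flow \<Rightarrow> bool" where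
  "right_continuous_flow f \<longleftrightarrow>
     (\<forall>e\<in>arcs G. \<forall>\<theta>. continuous (at_right \<theta>) (fst f e) \<and> continuous (at_right \<theta>) (snd f e))"

end

definition piecewise_constant_inflow :: "(real \<Rightarrow> real) \<Rightarrow> bool" where
  "piecewise_constant_inflow u \<longleftrightarrow>
     (\<forall>\<theta><0. u \<theta> = 0) \<and>
     (\<exists>\<xi> :: nat \<Rightarrow> real. strict_mono \<xi> \<and> \<xi> 0 = 0 \<and> filterlim \<xi> at_top sequentially \<and>
        (\<forall>k. u constant_on {\<xi> k..<\<xi> (Suc k)}))"

end

(* The right derivatives of the earliest-time functions of a right-continuous equilibrium form a thin
   flow with resetting, which depends only on the inflow rate and on two edge sets (active edges, edges
   with a queue) that can be read off the earliest-time functions. The thin flow is unique: if d > h on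
   a nonempty vertex set S for two thin flows, comparing the flows across the cut S contradicts the
   choice of a vertex of S that is topologically first in the acyclic graph of active edges.
   Since there are finitely many edge sets, the right-continuous derivative takes finitely many values
   while the inflow is constant, so it is constant just after each time. Hence two equilibria whose
   earliest-time functions agree up to some time agree a little longer. They agree at very early times,
   when there are no queues, and therefore always. *)

theory Submission
  imports Defs
begin

section \<open>Right derivatives\<close>

text \<open>Minima of path arrival times have kinks, and the conditions on a flow hold only almost
  everywhere. Both obstacles are met by looking to the right of each time:
  \<open>right_smooth\<close> functions survive minima and monotone compositions, and
  right-continuity turns an almost-everywhere condition into one at every time. The equilibrium
  condition speaks of an image of inactive times and cannot be differentiated; it is first turned
  into the identity \<open>P e (l v x) = M e (l w x)\<close> for an edge \<open>e\<close> from
  \<open>v\<close> to \<open>w\<close> (\<open>inflow_eq_outflow\<close>), whose right derivative is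
  the thin flow on \<open>e\<close>. The same identity shows that an edge with a queue at
  \<open>l v x\<close> is active, which is why both edge sets can be found by comparing
  \<open>l v x + \<tau> e\<close> with \<open>l w x\<close>. Only the vertex part of a thin flow is
  shown to be unique; the arc flows are not claimed to agree. Nothing here excludes that intervals
  of constant slope accumulate, so agreement is extended by a supremum argument and not interval by
  interval.\<close>

lemma frequently_at_right_of_AE:
  fixes a b :: real
  assumes "AE x in lebesgue. a < x \<and> x < b \<longrightarrow> P x" and "a < b"
  shows "frequently P (at_right a)"
  unfolding frequently_def
proof
  assume "eventually (\<lambda>x. \<not> P x) (at_right a)"
  then obtain c where c: "c > a" "\<And>y. a < y \<Longrightarrow> y < c \<Longrightarrow> \<not> P y"
    unfolding eventually_at_right_field by blast
  define d where "d = min b c"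
  have "a < d" using c(1) assms(2) by (simp add: d_def)
  have "AE x in lebesgue. x \<notin> {a<..<d}"
    using assms(1) by eventually_elim (use c d_def in auto)
  hence "{a<..<d} \<in> null_sets lebesgue"
    by (subst (asm) AE_iff_null_sets[symmetric]) auto
  hence "emeasure lebesgue {a<..<d} = 0" by auto
  thus False using \<open>a < d\<close> by simp
qed

text \<open>An almost-everywhere inequality holds at points arbitrarily close to the right of
  \<open>a\<close>, so it passes to the right limits. This and its equality version make the
  conditions on a right-continuous flow hold at every time.\<close>

lemma right_limit_le_of_AE:
  fixes f g :: "real \<Rightarrow> real"
  assumes "AE x in lebesgue. a < x \<and> x < b \<longrightarrow> f x \<le> g x" and "a < b"
    and "continuous (at_right a) f" and "continuous (at_right a) g"
  shows "f a \<le> g a"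
proof (rule ccontr)
  assume "\<not> ?thesis"
  moreover have "((\<lambda>x. f x - g x) \<longlongrightarrow> f a - g a) (at_right a)"
    using assms(3,4) by (intro tendsto_diff) (auto simp: continuous_within)
  ultimately have "eventually (\<lambda>x. \<not> f x \<le> g x) (at_right a)"
    by (auto dest!: order_tendstoD(1)[where a = 0] elim!: eventually_mono)
  with frequently_at_right_of_AE[OF assms(1,2)] show False
    by (simp add: frequently_def)
qed

lemma right_limit_eq_of_AE:
  fixes f g :: "real \<Rightarrow> real"
  assumes "AE x in lebesgue. a < x \<and> x < b \<longrightarrow> f x = g x" and "a < b"
    and "continuous (at_right a) f" and "continuous (at_right a) g"
  shows "f a = g a"
proof (rule antisym)
  show "f a \<le> g a"
    by (rule right_limit_le_of_AE[OF _ assms(2-4)]) (use assms(1) in \<open>eventually_elim, auto\<close>)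
  show "g a \<le> f a"
    by (rule right_limit_le_of_AE[OF _ assms(2,4,3)]) (use assms(1) in \<open>eventually_elim, auto\<close>)
qed

lemma right_derivative_unique:
  fixes f :: "real \<Rightarrow> real"
  assumes "(f has_real_derivative a) (at_right x)" "(f has_real_derivative b) (at_right x)"
  shows "a = b"
  using assms by (auto simp: has_field_derivative_iff intro: tendsto_unique[rotated])

text \<open>The quotients of \<open>f - g\<close> converge to \<open>a - b\<close> and vanish
  arbitrarily close to \<open>x\<close>. Agreement is asked for only frequently because an edge
  attaining the minimum at a vertex may do so only along a sequence of times.\<close>

lemma right_derivative_cong_frequently:
  fixes f g :: "real \<Rightarrow> real"
  assumes f: "(f has_real_derivative a) (at_right x)" and g: "(g has_real_derivative b) (at_right x)"
    and "f x = g x" and fr: "frequently (\<lambda>y. f y = g y) (at_right x)"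
  shows "a = b"
proof (rule ccontr)
  assume "a \<noteq> b"
  have "((\<lambda>y. (f y - f x) / (y - x) - (g y - g x) / (y - x)) \<longlongrightarrow> a - b) (at_right x)"
    using f g by (auto simp: has_field_derivative_iff intro: tendsto_diff)
  hence "eventually (\<lambda>y. (f y - f x) / (y - x) - (g y - g x) / (y - x) \<noteq> 0) (at_right x)"
    using \<open>a \<noteq> b\<close> by (intro tendsto_imp_eventually_ne) auto
  hence "eventually (\<lambda>y. f y \<noteq> g y) (at_right x)"
    by eventually_elim (use assms(3) in auto)
  with fr show False by (simp add: frequently_def)
qed

lemma right_derivative_le:
  fixes f g :: "real \<Rightarrow> real"
  assumes f: "(f has_real_derivative a) (at_right x)" and g: "(g has_real_derivative b) (at_right x)"
    and "f x = g x" and le: "\<And>y. y > x \<Longrightarrow> f y \<le> g y"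
  shows "a \<le> b"
proof (rule tendsto_le)
  show "((\<lambda>y. (g y - g x) / (y - x)) \<longlongrightarrow> b) (at_right x)"
    "((\<lambda>y. (f y - f x) / (y - x)) \<longlongrightarrow> a) (at_right x)"
    using f g by (auto simp: has_field_derivative_iff)
  show "eventually (\<lambda>y. (f y - f x) / (y - x) \<le> (g y - g x) / (y - x)) (at_right x)"
    using le assms(3) by (auto simp: eventually_at_right_field divide_right_mono intro!: exI[of _ "x + 1"])
qed simp

text \<open>Monotonicity keeps \<open>h\<close> to the right of \<open>h x\<close>, so a right
  derivative of the outer function suffices. Since \<open>h\<close> may be constant for a while, the
  image lies in the closed half-line.\<close>

lemma right_derivative_compose:
  fixes g h :: "real \<Rightarrow> real"
  assumes "mono h" "(h has_real_derivative a) (at_right x)"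
    "(g has_real_derivative b) (at_right (h x))"
  shows "((\<lambda>y. g (h y)) has_real_derivative b * a) (at_right x)"
proof -
  have "(g has_real_derivative b) (at (h x) within {h x..})"
    using assms(3) by (simp add: at_within_Ici_at_right)
  moreover have "h ` {x<..} \<subseteq> {h x..}" using assms(1) by (auto simp: mono_def)
  ultimately have "(g has_real_derivative b) (at (h x) within h ` {x<..})"
    by (rule DERIV_subset)
  from DERIV_image_chain[OF this assms(2)] show ?thesis by (simp add: o_def)
qed

text \<open>A mean value inequality for right derivatives: after subtracting a line of slope
  slightly below \<open>c\<close>, the function increases just after every point before
  \<open>b\<close>, so its maximum over the interval is at \<open>b\<close>.\<close>

lemma increment_ge_of_right_derivative:
  fixes f :: "real \<Rightarrow> real"
  assumes "a \<le> b" and cont: "continuous_on {a..b} f"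
    and deriv: "\<And>x. a \<le> x \<Longrightarrow> x < b \<Longrightarrow> \<exists>D\<ge>c. (f has_real_derivative D) (at_right x)"
  shows "c * (b - a) \<le> f b - f a"
proof (rule field_le_epsilon)
  fix e :: real assume "e > 0"
  \<comment> \<open>The \<open>+ 1\<close> keeps the denominator positive when \<open>a = b\<close>;
    the loss over the whole interval is still at most \<open>e\<close>.\<close>
  define k where "k = c - e / (b - a + 1)"
  define g where "g x = f x - k * x" for x
  have "continuous_on {a..b} g"
    unfolding g_def by (intro continuous_intros cont)
  then obtain x0 where x0: "x0 \<in> {a..b}" "\<And>y. y \<in> {a..b} \<Longrightarrow> g y \<le> g x0"
    using continuous_attains_sup[of "{a..b}" g] \<open>a \<le> b\<close> by auto
  have "x0 = b"
  proof (rule ccontr)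
    assume "x0 \<noteq> b"
    with x0(1) have "a \<le> x0" "x0 < b" by auto
    with deriv obtain D where D: "D \<ge> c" "(f has_real_derivative D) (at_right x0)" by blast
    have "(g has_real_derivative D - k) (at_right x0)"
      unfolding g_def by (auto intro!: derivative_eq_intros D(2))
    moreover have "D - k > 0"
      using D(1) \<open>e > 0\<close> \<open>a \<le> b\<close> by (simp add: k_def) (smt (verit) divide_pos_pos)
    ultimately obtain d where d: "d > 0" "\<And>h. h > 0 \<Longrightarrow> x0 + h \<in> {x0<..} \<Longrightarrow> h < d \<Longrightarrow> g x0 < g (x0 + h)"
      using has_real_derivative_pos_inc_right by blast
    define h where "h = min (d / 2) (b - x0)"
    have "h > 0" "h < d" "x0 + h \<le> b" using d(1) \<open>x0 < b\<close> by (auto simp: h_def)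
    with d(2)[of h] x0(2)[of "x0 + h"] \<open>a \<le> x0\<close> show False by auto
  qed
  with x0(2)[of a] \<open>a \<le> b\<close> have "g a \<le> g b" by simp
  hence "k * (b - a) \<le> f b - f a" by (simp add: g_def algebra_simps)
  moreover have "c * (b - a) - k * (b - a) = e * ((b - a) / (b - a + 1))"
    by (simp add: k_def algebra_simps)
  moreover have "\<dots> \<le> e * 1"
    using \<open>e > 0\<close> \<open>a \<le> b\<close> by (intro mult_left_mono) auto
  ultimately show "c * (b - a) \<le> f b - f a + e" by linarith
qed

lemma increment_le_of_right_derivative:
  fixes f :: "real \<Rightarrow> real"
  assumes "a \<le> b" and cont: "continuous_on {a..b} f"
    and deriv: "\<And>x. a \<le> x \<Longrightarrow> x < b \<Longrightarrow> \<exists>D\<le>c. (f has_real_derivative D) (at_right x)"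
  shows "f b - f a \<le> c * (b - a)"
proof -
  have "- c * (b - a) \<le> - f b - - f a"
  proof (rule increment_ge_of_right_derivative[OF \<open>a \<le> b\<close>])
    show "continuous_on {a..b} (\<lambda>x. - f x)" by (intro continuous_intros cont)
    fix x assume "a \<le> x" "x < b"
    then obtain D where "D \<le> c" "(f has_real_derivative D) (at_right x)" using deriv by blast
    thus "\<exists>D\<ge>- c. ((\<lambda>x. - f x) has_real_derivative D) (at_right x)"
      by (intro exI[of _ "- D"]) (auto intro!: derivative_eq_intros)
  qed
  thus ?thesis by simp
qed

lemma increment_eq_of_right_derivative:
  fixes f :: "real \<Rightarrow> real"
  assumes "a \<le> b" "continuous_on {a..b} f"
    and "\<And>x. a \<le> x \<Longrightarrow> x < b \<Longrightarrow> (f has_real_derivative c) (at_right x)"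
  shows "f b - f a = c * (b - a)"
  using increment_ge_of_right_derivative[of a b f c] increment_le_of_right_derivative[of a b f c] assms
  by (intro antisym) blast+

text \<open>Right-continuity of the derivative is part of the notion since it is needed when slopes
  with finitely many values are shown to be constant just after a time.\<close>

definition right_smooth :: "(real \<Rightarrow> real) \<Rightarrow> (real \<Rightarrow> real) \<Rightarrow> bool" where
  "right_smooth f f' \<longleftrightarrow> continuous_on UNIV f \<and>
     (\<forall>x. (f has_real_derivative f' x) (at_right x) \<and> continuous (at_right x) f')"

lemma right_smooth_ident: "right_smooth (\<lambda>x. x) (\<lambda>x. 1)"
  by (auto simp: right_smooth_def intro!: derivative_eq_intros continuous_intros)

lemma right_smooth_compose:
  assumes "mono h" "right_smooth h h'" "right_smooth g g'"
  shows "right_smooth (\<lambda>x. g (h x)) (\<lambda>x. g' (h x) * h' x)"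
  unfolding right_smooth_def
proof (intro conjI allI)
  have hc: "continuous_on UNIV h" and gc: "continuous_on UNIV g"
    using assms by (auto simp: right_smooth_def)
  show "continuous_on UNIV (\<lambda>x. g (h x))"
    using continuous_on_compose2[OF gc hc] by auto
  fix x
  show "((\<lambda>y. g (h y)) has_real_derivative g' (h x) * h' x) (at_right x)"
    using assms by (intro right_derivative_compose) (auto simp: right_smooth_def)
  have g'c: "continuous (at (h x) within {h x..}) g'"
    using assms(3) by (simp add: right_smooth_def at_within_Ici_at_right)
  have "continuous (at (h x) within h ` {x<..}) g'"
    by (rule continuous_within_subset[OF g'c]) (use assms(1) in \<open>auto simp: mono_def\<close>)
  moreover have "continuous (at_right x) h"
    using hc continuous_on_eq_continuous_at continuous_at_imp_continuous_at_within by blast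
  ultimately have "continuous (at_right x) (\<lambda>y. g' (h y))"
    by (rule continuous_within_compose2[rotated])
  thus "continuous (at_right x) (\<lambda>x. g' (h x) * h' x)"
    using assms(2) by (intro continuous_intros) (auto simp: right_smooth_def)
qed

text \<open>Where the values tie, the function with the smaller right derivative is the minimum just
  afterwards.\<close>

lemma right_smooth_min:
  assumes "right_smooth f f'" "right_smooth g g'"
  shows "right_smooth (\<lambda>x. min (f x) (g x))
    (\<lambda>x. if f x < g x then f' x else if g x < f x then g' x else min (f' x) (g' x))"
    (is "right_smooth ?m ?m'")
  unfolding right_smooth_def
proof (intro conjI allI)
  have fc: "continuous_on UNIV f" and gc: "continuous_on UNIV g"
    using assms by (auto simp: right_smooth_def)
  show "continuous_on UNIV ?m" by (intro continuous_intros fc gc)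
  fix x
  have "isCont (\<lambda>y. g y - f y) x"
    using fc gc by (intro continuous_intros) (auto simp: continuous_on_eq_continuous_at)
  hence lim: "((\<lambda>y. g y - f y) \<longlongrightarrow> g x - f x) (at_right x)"
    by (meson continuous_at_imp_continuous_at_within continuous_within)
  have f'lim: "(f' \<longlongrightarrow> f' x) (at_right x)" and g'lim: "(g' \<longlongrightarrow> g' x) (at_right x)"
    using assms by (auto simp: right_smooth_def continuous_within)
  have f': "((\<lambda>y. (f y - f x) / (y - x)) \<longlongrightarrow> f' x) (at_right x)"
    and g': "((\<lambda>y. (g y - g x) / (y - x)) \<longlongrightarrow> g' x) (at_right x)"
    using assms by (auto simp: right_smooth_def has_field_derivative_iff)
  have gt: "eventually (\<lambda>y. y > x) (at_right x)" by (rule eventually_at_right_less)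
  consider "f x < g x" | "g x < f x" | "f x = g x" by linarith
  note cs = this
  show "(?m has_real_derivative ?m' x) (at_right x)"
    using cs
  proof cases
    case 1
    hence "eventually (\<lambda>y. 0 < g y - f y) (at_right x)" by (intro order_tendstoD(1)[OF lim]) simp
    hence "eventually (\<lambda>y. (f y - f x) / (y - x) = (?m y - ?m x) / (y - x)) (at_right x)"
      by eventually_elim (use 1 in auto)
    from Lim_transform_eventually[OF f' this] show ?thesis using 1 by (simp add: has_field_derivative_iff)
  next
    case 2
    hence "eventually (\<lambda>y. g y - f y < 0) (at_right x)" by (intro order_tendstoD(2)[OF lim]) simp
    hence "eventually (\<lambda>y. (g y - g x) / (y - x) = (?m y - ?m x) / (y - x)) (at_right x)"
      by eventually_elim (use 2 in auto)
    from Lim_transform_eventually[OF g' this] show ?thesis using 2 by (simp add: has_field_derivative_iff)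
  next
    case 3
    have "eventually (\<lambda>y. min ((f y - f x) / (y - x)) ((g y - g x) / (y - x)) = (?m y - ?m x) / (y - x)) (at_right x)"
      using gt
    proof eventually_elim
      case (elim y)
      thus ?case using 3 by (auto simp: min_def divide_right_mono divide_le_cancel)
    qed
    from Lim_transform_eventually[OF tendsto_min[OF f' g'] this] show ?thesis
      using 3 by (simp add: has_field_derivative_iff)
  qed
  show "continuous (at_right x) ?m'"
    unfolding continuous_within
  proof -
    consider "f x < g x \<or> f x = g x \<and> f' x < g' x" | "g x < f x \<or> f x = g x \<and> g' x < f' x"
      | "f x = g x" "f' x = g' x" by linarith
    thus "(?m' \<longlongrightarrow> ?m' x) (at_right x)"
    proof cases
      case 1
      have "eventually (\<lambda>y. f y < g y) (at_right x)"
      proof (cases "f x < g x")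
        case True
        hence "eventually (\<lambda>y. 0 < g y - f y) (at_right x)" by (intro order_tendstoD(1)[OF lim]) simp
        thus ?thesis by eventually_elim auto
      next
        case False
        with 1 have eq: "f x = g x" "f' x < g' x" by auto
        from tendsto_diff[OF g' f'] eq
        have "eventually (\<lambda>y. 0 < (g y - g x) / (y - x) - (f y - f x) / (y - x)) (at_right x)"
          by (intro order_tendstoD(1)) auto
        thus ?thesis using gt
          by eventually_elim (use eq in \<open>auto simp: diff_divide_distrib[symmetric] zero_less_divide_iff\<close>)
      qed
      hence "eventually (\<lambda>y. f' y = ?m' y) (at_right x)" by eventually_elim auto
      from Lim_transform_eventually[OF f'lim this] show ?thesis using 1 by (auto split: if_splits)
    next
      case 2
      have "eventually (\<lambda>y. g y < f y) (at_right x)"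
      proof (cases "g x < f x")
        case True
        hence "eventually (\<lambda>y. g y - f y < 0) (at_right x)" by (intro order_tendstoD(2)[OF lim]) simp
        thus ?thesis by eventually_elim auto
      next
        case False
        with 2 have eq: "f x = g x" "g' x < f' x" by auto
        from tendsto_diff[OF g' f'] eq
        have "eventually (\<lambda>y. (g y - g x) / (y - x) - (f y - f x) / (y - x) < 0) (at_right x)"
          by (intro order_tendstoD(2)) auto
        thus ?thesis using gt
          by eventually_elim (use eq in \<open>auto simp: diff_divide_distrib[symmetric] divide_less_0_iff\<close>)
      qed
      hence "eventually (\<lambda>y. g' y = ?m' y) (at_right x)" by eventually_elim auto
      from Lim_transform_eventually[OF g'lim this] show ?thesis using 2 by (auto split: if_splits)
    next
      case 3
      \<comment> \<open>The minimum may switch between \<open>f\<close> and \<open>g\<close>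
        infinitely often after \<open>x\<close>, but its derivative always lies between
        \<open>min (f' y) (g' y)\<close> and \<open>max (f' y) (g' y)\<close>, which have the same
        limit.\<close>
      hence mx: "?m' x = min (f' x) (g' x)" "?m' x = max (f' x) (g' x)" by auto
      show ?thesis
      proof (rule tendsto_sandwich)
        show "((\<lambda>y. min (f' y) (g' y)) \<longlongrightarrow> ?m' x) (at_right x)"
          unfolding mx(1) by (rule tendsto_min[OF f'lim g'lim])
        show "((\<lambda>y. max (f' y) (g' y)) \<longlongrightarrow> ?m' x) (at_right x)"
          unfolding mx(2) by (rule tendsto_max[OF f'lim g'lim])
      qed (auto intro!: always_eventually)
    qed
  qed
qed

lemma right_smooth_Min:
  assumes "finite I" "I \<noteq> {}" "\<And>i. i \<in> I \<Longrightarrow> \<exists>f'. right_smooth (f i) f'"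
  shows "\<exists>f'. right_smooth (\<lambda>x. Min ((\<lambda>i. f i x) ` I)) f'"
  using assms
proof (induction I rule: finite_ne_induct)
  case (insert i I)
  obtain f1 where "right_smooth (f i) f1" using insert.prems by blast
  moreover obtain f2 where "right_smooth (\<lambda>x. Min ((\<lambda>i. f i x) ` I)) f2"
    using insert.IH insert.prems by blast
  ultimately have "\<exists>f1 f2. right_smooth (f i) f1 \<and> right_smooth (\<lambda>x. Min ((\<lambda>i. f i x) ` I)) f2" by blast
  then obtain f1 f2 where "right_smooth (f i) f1" "right_smooth (\<lambda>x. Min ((\<lambda>i. f i x) ` I)) f2" by blast
  from right_smooth_min[OF this] show ?case using insert by auto
qed auto

section \<open>Cumulative flows\<close>

text \<open>Replaces the oriented Lebesgue integral from \<open>0\<close>, whose sign changes for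
  negative arguments, by a gauge integral with a free base point.\<close>

lemma cumulative_diff:
  assumes "f \<in> F0" "a \<le> b"
  shows "cumulative f b - cumulative f a = integral {a..b} f"
proof -
  have si: "set_integrable lebesgue {x..y} f" for x y using assms(1) by (auto simp: F0_def)
  have int: "f integrable_on {x..y}" for x y
    using set_lebesgue_integral_eq_integral(1)[OF si] .
  have "set_integrable lebesgue {x<..<y} f" for x y
    by (rule set_integrable_subset[OF si[of x y]]) auto
  hence op: "(LINT z:{x<..<y}|lebesgue. f z) = integral {x..y} f" for x y
    by (simp add: set_lebesgue_integral_eq_integral(2) integral_open_interval_real)
  have cum: "cumulative f x = (if 0 \<le> x then integral {0..x} f else - integral {x..0} f)" for x
    using op[of 0 x] op[of x 0]
    by (auto simp: cumulative_def interval_lebesgue_integral_def zero_ereal_def[symmetric])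
      (simp_all add: zero_ereal_def einterval_eq)
  consider "0 \<le> a" | "a < 0" "0 \<le> b" | "b < 0" by linarith
  thus ?thesis
  proof cases
    case 1
    thus ?thesis using assms(2) Henstock_Kurzweil_Integration.integral_combine[OF 1 assms(2) int] by (simp add: cum)
  next
    case 2
    thus ?thesis using assms(2) Henstock_Kurzweil_Integration.integral_combine[of a 0 b f] int by (simp add: cum)
  next
    case 3
    thus ?thesis using assms(2) Henstock_Kurzweil_Integration.integral_combine[of a b 0 f] int by (simp add: cum)
  qed
qed

lemma cumulative_0 [simp]: "cumulative f 0 = 0"
  by (simp add: cumulative_def interval_lebesgue_integral_def set_lebesgue_integral_def
      zero_ereal_def[symmetric] einterval_same)

lemma right_smooth_cumulative:
  assumes F0: "f \<in> F0" and rc: "\<And>x. continuous (at_right x) f"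
  shows "right_smooth (cumulative f) f"
  unfolding right_smooth_def
proof (intro conjI allI rc)
  have int: "f integrable_on {x..y}" for x y
    using F0 set_lebesgue_integral_eq_integral(1)[of "{x..y}" f] by (auto simp: F0_def)
  have eq: "cumulative f y = cumulative f a + integral {a..y} f" if "a \<le> y" for a y
    using cumulative_diff[OF F0 that] by simp
  have "isCont (cumulative f) x" for x
  proof -
    have "continuous_on {x - 1..x + 1} (\<lambda>y. cumulative f (x - 1) + integral {x - 1..y} f)"
      by (intro continuous_intros indefinite_integral_continuous_1 int)
    hence "continuous_on {x - 1..x + 1} (cumulative f)"
      by (rule continuous_on_eq) (auto intro: eq[symmetric])
    thus ?thesis
      by (rule continuous_on_interior) auto
  qed
  thus "continuous_on UNIV (cumulative f)" by (simp add: continuous_on_eq_continuous_at)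
  fix x
  have rc': "continuous (at x within {x..x+1}) f"
    using rc[of x] by (simp add: at_within_Icc_at_right)
  from integral_has_vector_derivative_continuous_at[OF int[of x "x + 1"], of x "{}"] rc'
  have "((\<lambda>u. integral {x..u} f) has_vector_derivative f x) (at x within {x..x+1})"
    by simp
  hence "((\<lambda>u. cumulative f x + integral {x..u} f) has_real_derivative f x) (at x within {x..x+1})"
    by (auto simp: has_real_derivative_iff_has_vector_derivative[symmetric] intro!: derivative_eq_intros)
  hence "(cumulative f has_real_derivative f x) (at x within {x..x+1})"
    by (rule has_field_derivative_transform_within[OF _ zero_less_one]) (auto intro: eq[symmetric])
  thus "(cumulative f has_real_derivative f x) (at_right x)"
    by (simp add: at_within_Icc_at_right)
qed

section \<open>Thin flows\<close>

context flow_network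
begin

text \<open>Summation by parts on the graph. For \<open>c\<close> the indicator of a vertex set, the
  right-hand side is the net flow across its cut.\<close>

lemma sum_net_outflow_weighted:
  fixes x :: "'e \<Rightarrow> real" and c :: "'v \<Rightarrow> real"
  shows "(\<Sum>v\<in>verts G. c v * ((\<Sum>e\<in>out_arcs G v. x e) - (\<Sum>e\<in>in_arcs G v. x e)))
    = (\<Sum>e\<in>arcs G. x e * (c (tail G e) - c (head G e)))"
proof -
  have out: "out_arcs G v = {e \<in> arcs G. tail G e = v}" and inn: "in_arcs G v = {e \<in> arcs G. head G e = v}" for v
    by auto
  have "(\<Sum>v\<in>verts G. c v * (\<Sum>e\<in>out_arcs G v. x e)) = (\<Sum>v\<in>verts G. \<Sum>e | e \<in> arcs G \<and> tail G e = v. x e * c (tail G e))"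
    unfolding out sum_distrib_left by (intro sum.cong refl) auto
  also have "\<dots> = (\<Sum>e\<in>arcs G. x e * c (tail G e))"
    by (rule sum.group) auto
  finally have 1: "(\<Sum>v\<in>verts G. c v * (\<Sum>e\<in>out_arcs G v. x e)) = (\<Sum>e\<in>arcs G. x e * c (tail G e))" .
  have "(\<Sum>v\<in>verts G. c v * (\<Sum>e\<in>in_arcs G v. x e)) = (\<Sum>v\<in>verts G. \<Sum>e | e \<in> arcs G \<and> head G e = v. x e * c (head G e))"
    unfolding inn sum_distrib_left by (intro sum.cong refl) auto
  also have "\<dots> = (\<Sum>e\<in>arcs G. x e * c (head G e))"
    by (rule sum.group) auto
  finally have 2: "(\<Sum>v\<in>verts G. c v * (\<Sum>e\<in>in_arcs G v. x e)) = (\<Sum>e\<in>arcs G. x e * c (head G e))" .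
  show ?thesis
    using 1 2 by (simp add: right_diff_distrib sum_subtractf)
qed

text \<open>The weight \<open>1\<close> shows that the net outflow vanishes at \<open>t\<close> as
  well, because each arc cancels in the total.\<close>

lemma circulation_of_zero_net_outflow:
  fixes x :: "'e \<Rightarrow> real" and c :: "'v \<Rightarrow> real"
  assumes "\<And>v. v \<in> verts G - {t} \<Longrightarrow> (\<Sum>e\<in>out_arcs G v. x e) - (\<Sum>e\<in>in_arcs G v. x e) = 0"
  shows "(\<Sum>e\<in>arcs G. x e * (c (tail G e) - c (head G e))) = 0"
proof -
  define net where "net v = (\<Sum>e\<in>out_arcs G v. x e) - (\<Sum>e\<in>in_arcs G v. x e)" for v
  have "(\<Sum>v\<in>verts G. a v * net v) = a t * net t" for a :: "'v \<Rightarrow> real"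
    using assms sink_in_verts by (subst sum.remove[of _ t]) (auto simp: net_def)
  from this[of "\<lambda>_. 1"] this[of c] show ?thesis
    using sum_net_outflow_weighted[of "\<lambda>_. 1" x] sum_net_outflow_weighted[of c x]
    by (simp add: net_def)
qed

text \<open>\<open>A\<close> plays the role of the active edges and \<open>B\<close> of the edges with a queue. The relation
  \<open>\<ge>\<close> of the paper's requirement \<open>d w = min (\<rho> e)\<close> is kept only in the weak form that the
  uniqueness argument needs.\<close>

definition thin_flow :: "'e set \<Rightarrow> 'e set \<Rightarrow> real \<Rightarrow> ('v \<Rightarrow> real) \<Rightarrow> ('e \<Rightarrow> real) \<Rightarrow> bool" where
  "thin_flow A B u0 d x \<longleftrightarrow> d s = 1 \<and>
     (\<forall>e\<in>arcs G. 0 \<le> x e \<and> (e \<notin> A \<longrightarrow> x e = 0) \<and>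
        (e \<in> B \<longrightarrow> \<nu> e * d (head G e) = x e) \<and>
        (e \<in> A - B \<longrightarrow> d (head G e) \<le> max (d (tail G e)) (x e / \<nu> e) \<and> x e \<le> \<nu> e * d (head G e)
            \<and> (0 < x e \<longrightarrow> d (tail G e) \<le> d (head G e)))) \<and>
     (\<forall>w\<in>verts G - {s}. \<exists>e\<in>A. head G e = w \<and> (e \<in> B \<or> d (tail G e) \<le> d w)) \<and>
     (\<forall>v\<in>verts G - {t}. (\<Sum>e\<in>out_arcs G v. x e) - (\<Sum>e\<in>in_arcs G v. x e) = (if v = s then u0 else 0))"

text \<open>If an arc without queue carries \<open>x e > 0\<close>, then \<open>h (tail G e) < d
  (tail G e) \<le> d (head G e) \<le> h (head G e)\<close>, so the maximum bounding
  \<open>h (head G e)\<close> must be \<open>y e / \<nu> e\<close>.\<close>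

lemma thin_flow_leaving_cut:
  assumes "thin_flow A B u0 d x" "thin_flow A B u0 h y" "e \<in> arcs G"
    and "h (tail G e) < d (tail G e)" "d (head G e) \<le> h (head G e)"
  shows "x e \<le> y e"
proof -
  have nu: "0 < \<nu> e" using assms(3) service_rate_pos by blast
  have le: "\<nu> e * d (head G e) \<le> \<nu> e * h (head G e)"
    using assms(5) nu by (intro mult_left_mono) auto
  consider "e \<notin> A" "e \<notin> B" | "e \<in> B" | "e \<in> A - B" by blast
  thus ?thesis
  proof cases
    case 1
    thus ?thesis using assms(1-3) by (auto simp: thin_flow_def)
  next
    case 2
    thus ?thesis using assms(1-3) le by (auto simp: thin_flow_def)
  next
    case 3
    have y: "0 \<le> y e" "h (head G e) \<le> max (h (tail G e)) (y e / \<nu> e)"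
      using assms(2,3) 3 by (auto simp: thin_flow_def)
    have x: "x e \<le> \<nu> e * d (head G e)" "0 < x e \<Longrightarrow> d (tail G e) \<le> d (head G e)"
      using assms(1,3) 3 by (auto simp: thin_flow_def)
    show ?thesis
    proof (cases "0 < x e")
      case True
      with x(2) assms(4,5) y(2) have "h (head G e) \<le> y e / \<nu> e" by linarith
      hence "\<nu> e * h (head G e) \<le> y e" using nu by (simp add: field_simps)
      with x(1) le show ?thesis by linarith
    qed (use y(1) in simp)
  qed
qed

text \<open>The equality case for arcs into the cut: had \<open>d (head G e)\<close> been bounded by
  \<open>x e / \<nu> e = y e / \<nu> e\<close>, it could not exceed \<open>h (head G e)\<close>. The
  conclusion is what a predecessor arc for \<open>h\<close> cannot satisfy.\<close>

lemma thin_flow_entering_cut: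
  assumes d: "thin_flow A B u0 d x" and h: "thin_flow A B u0 h y" and e: "e \<in> arcs G" "e \<in> A"
    and tail: "d (tail G e) \<le> h (tail G e)" and head: "h (head G e) < d (head G e)" and "x e = y e"
  shows "e \<notin> B" "h (head G e) < h (tail G e)"
proof -
  have nu: "0 < \<nu> e" using e service_rate_pos by blast
  have lt: "\<nu> e * h (head G e) < \<nu> e * d (head G e)"
    using head nu by simp
  show nB: "e \<notin> B"
  proof
    assume "e \<in> B"
    hence "\<nu> e * d (head G e) = x e" "\<nu> e * h (head G e) = y e"
      using d h e(1) by (auto simp: thin_flow_def)
    with lt \<open>x e = y e\<close> show False by simp
  qed
  have y: "0 \<le> y e" "y e \<le> \<nu> e * h (head G e)" "0 < y e \<Longrightarrow> h (tail G e) \<le> h (head G e)"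
    using h e nB by (auto simp: thin_flow_def)
  have x: "d (head G e) \<le> max (d (tail G e)) (x e / \<nu> e)"
    using d e nB by (auto simp: thin_flow_def)
  show "h (head G e) < h (tail G e)"
  proof (cases "d (head G e) \<le> d (tail G e)")
    case True
    thus ?thesis using tail head by linarith
  next
    case False
    with x have "d (head G e) \<le> x e / \<nu> e" by linarith
    hence "\<nu> e * d (head G e) \<le> x e" using nu by (simp add: field_simps)
    with lt y(2) \<open>x e = y e\<close> show ?thesis by linarith
  qed
qed

lemma thin_flow_le:
  assumes d: "thin_flow A B u0 d x" and h: "thin_flow A B u0 h y"
    and A: "A \<subseteq> arcs G" and acyc: "acyclic ((\<lambda>e. (tail G e, head G e)) ` A)" and v: "v \<in> verts G"
  shows "d v \<le> h v"
proof (rule ccontr)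
  assume "\<not> d v \<le> h v"
  define S where "S = {v \<in> verts G. h v < d v}"
  have "v \<in> S" using \<open>\<not> d v \<le> h v\<close> v by (simp add: S_def)
  define c :: "'v \<Rightarrow> real" where "c v = (if v \<in> S then 1 else 0)" for v
  define D where "D e = x e - y e" for e
  have "(\<Sum>e\<in>arcs G. D e * (c (tail G e) - c (head G e))) = 0"
  proof (rule circulation_of_zero_net_outflow)
    fix v assume "v \<in> verts G - {t}"
    hence "(\<Sum>e\<in>out_arcs G v. x e) - (\<Sum>e\<in>in_arcs G v. x e) = (\<Sum>e\<in>out_arcs G v. y e) - (\<Sum>e\<in>in_arcs G v. y e)"
      using d h by (simp add: thin_flow_def)
    thus "(\<Sum>e\<in>out_arcs G v. D e) - (\<Sum>e\<in>in_arcs G v. D e) = 0"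
      by (simp add: D_def sum_subtractf)
  qed
  moreover have "D e * (c (tail G e) - c (head G e)) \<le> 0" if e: "e \<in> arcs G" for e
  proof -
    have V: "tail G e \<in> verts G" "head G e \<in> verts G" using e by auto
    consider "tail G e \<in> S" "head G e \<notin> S" | "tail G e \<notin> S" "head G e \<in> S"
      | "tail G e \<in> S \<longleftrightarrow> head G e \<in> S" by blast
    thus ?thesis
    proof cases
      case 1
      have "x e \<le> y e" by (rule thin_flow_leaving_cut[OF d h e]) (use 1 V in \<open>auto simp: S_def\<close>)
      thus ?thesis using 1 by (simp add: c_def D_def)
    next
      case 2
      \<comment> \<open>For \<open>e\<close> in \<open>A - B\<close>, either
        \<open>d (head G e) \<le> x e / \<nu> e\<close>, and then
        \<open>y e \<le> \<nu> e * h (head G e)\<close> gives the claim, or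
        \<open>d (head G e) \<le> d (tail G e)\<close>, so \<open>h\<close> drops along
        \<open>e\<close> and \<open>y e = 0\<close>.\<close>
      have "y e \<le> x e"
      proof (cases "e \<in> A")
        case True
        have nu: "0 < \<nu> e" using e service_rate_pos by blast
        have "\<nu> e * h (head G e) \<le> \<nu> e * d (head G e)" using 2 nu by (simp add: S_def)
        moreover have "d (tail G e) \<le> h (tail G e)" "h (head G e) < d (head G e)" using 2 V by (auto simp: S_def)
        moreover have "e \<in> B \<or> e \<in> A - B" using True by blast
        moreover have "d (head G e) \<le> x e / \<nu> e \<Longrightarrow> \<nu> e * d (head G e) \<le> x e" using nu by (simp add: field_simps)
        ultimately show ?thesis using d h e nu True
          unfolding thin_flow_def by (smt (verit, best))
      next
        case False
        thus ?thesis using d h e by (auto simp: thin_flow_def)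
      qed
      thus ?thesis using 2 by (simp add: c_def D_def)
    qed (auto simp: c_def)
  qed
  \<comment> \<open>The cut terms are nonpositive and add up to zero, so \<open>x\<close> and
    \<open>y\<close> agree on every arc crossing the cut.\<close>
  ultimately have D0: "D e * (c (tail G e) - c (head G e)) = 0" if "e \<in> arcs G" for e
    using that sum_nonneg_eq_0_iff[OF finite_arcs, of "\<lambda>e. - (D e * (c (tail G e) - c (head G e)))"]
    unfolding sum_negf neg_equal_0_iff_equal neg_0_le_iff_le by blast
  have "finite ((\<lambda>e. (tail G e, head G e)) ` A)" using finite_subset[OF A finite_arcs] by (rule finite_imageI)
  hence "wf ((\<lambda>e. (tail G e, head G e)) ` A)" using acyc by (rule finite_acyclic_wf)
  then obtain w where w: "w \<in> S" "\<And>v. (v, w) \<in> (\<lambda>e. (tail G e, head G e)) ` A \<Longrightarrow> v \<notin> S"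
    using \<open>v \<in> S\<close> by (rule wfE_min) blast
  have "w \<noteq> s" using w(1) d h by (auto simp: S_def thin_flow_def)
  \<comment> \<open>The predecessor arc is taken from \<open>h\<close>, the smaller of the two at
    \<open>w\<close>; by the choice of \<open>w\<close> its tail lies outside
    \<open>S\<close>.\<close>
  then obtain e where e: "e \<in> A" "head G e = w" "e \<in> B \<or> h (tail G e) \<le> h w"
    using w(1) h unfolding S_def thin_flow_def by blast
  have arc: "e \<in> arcs G" using e(1) A by blast
  have nS: "tail G e \<notin> S" using w(2) e by auto
  have "x e = y e" using D0[OF arc] e(2) w(1) nS by (simp add: c_def D_def)
  moreover have "d (tail G e) \<le> h (tail G e)" using nS arc by (auto simp: S_def)
  moreover have "h (head G e) < d (head G e)" using e(2) w(1) by (simp add: S_def)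
  ultimately have "e \<notin> B" "h (head G e) < h (tail G e)"
    using thin_flow_entering_cut[OF d h arc e(1)] by blast+
  with e show False by simp
qed

lemma thin_flow_unique:
  assumes "thin_flow A B u0 d x" "thin_flow A B u0 h y"
    and "A \<subseteq> arcs G" "acyclic ((\<lambda>e. (tail G e, head G e)) ` A)" "v \<in> verts G"
  shows "d v = h v"
  using thin_flow_le[OF assms(1,2)] thin_flow_le[OF assms(2,1)] assms(3-) by (intro antisym) auto

section \<open>Walks\<close>

text \<open>Positivity is assumed only for cycles. A closed walk that is not one has a repeated
  vertex after its first edge, hence a shorter closed subwalk; the other edges contribute
  nonnegative times.\<close>

lemma sum_list_travel_time_closed_walk_pos:
  assumes "awalk v p v" "p \<noteq> []"
  shows "0 < sum_list (map \<tau> p)"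
  using assms
proof (induction "length p" arbitrary: v p rule: less_induct)
  case less
  show ?case
  proof (cases "distinct (tl (awalk_verts v p))")
    case True
    hence "cycle p" "distinct p"
      using less.prems distinct_tl_verts_imp_distinct by (auto simp: cycle_def)
    thus ?thesis using cycle_travel_time_pos[of p] by (simp add: sum_list_distinct_conv_sum_set)
  next
    case False
    obtain e es where p: "p = e # es" using less.prems(2) by (cases p) auto
    have es: "awalk (head G e) es v" "\<not> distinct (awalk_verts (head G e) es)"
      using less.prems(1) False by (auto simp: p awalk_Cons_iff)
    obtain q r s' w where qrs: "es = q @ r @ s'" "awalk w r w" "0 < length r"
      using awalk_not_distinct_decomp[OF es] by blast
    have "0 < sum_list (map \<tau> r)"
      by (rule less.hyps[OF _ qrs(2)]) (use p qrs in auto)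
    moreover have "0 \<le> \<tau> a" if "a \<in> set p" for a
      using less.prems(1) that travel_time_nonneg by (auto simp: awalk_def)
    hence "0 \<le> \<tau> e" "0 \<le> sum_list (map \<tau> q)" "0 \<le> sum_list (map \<tau> s')"
      by (auto intro!: sum_list_nonneg simp: p qrs(1))
    ultimately show ?thesis by (simp add: p qrs(1))
  qed
qed

text \<open>Around a closed walk the inequalities telescope to a total travel time of at most zero.
  Single edges may have travel time zero, so the potential need not increase strictly along each
  edge.\<close>

lemma acyclic_of_potential:
  fixes l :: "'v \<Rightarrow> real"
  assumes A: "A \<subseteq> arcs G" and pot: "\<And>e. e \<in> A \<Longrightarrow> l (tail G e) + \<tau> e \<le> l (head G e)"
  shows "acyclic ((\<lambda>e. (tail G e, head G e)) ` A)"
proof (rule acyclicI, intro allI notI)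
  fix v assume "(v, v) \<in> ((\<lambda>e. (tail G e, head G e)) ` A)\<^sup>+"
  moreover have "\<exists>p. awalk v p w \<and> p \<noteq> [] \<and> l v + sum_list (map \<tau> p) \<le> l w"
    if "(v, w) \<in> ((\<lambda>e. (tail G e, head G e)) ` A)\<^sup>+" for w
    using that
  proof (induction rule: trancl_induct)
    case (base w)
    then obtain e where e: "e \<in> A" "v = tail G e" "w = head G e" by auto
    hence "awalk v [e] w" using A by (auto intro: arc_implies_awalk)
    thus ?case using pot[OF e(1)] e by (intro exI[of _ "[e]"]) auto
  next
    case (step w w')
    then obtain p e where p: "awalk v p w" "p \<noteq> []" "l v + sum_list (map \<tau> p) \<le> l w"
      and e: "e \<in> A" "w = tail G e" "w' = head G e" by auto
    have "awalk w [e] w'" using A e by (auto intro: arc_implies_awalk)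
    hence "awalk v (p @ [e]) w'" using p(1) by auto
    thus ?case using pot[OF e(1)] e p by (intro exI[of _ "p @ [e]"]) auto
  qed
  ultimately obtain p where p: "awalk v p v" "p \<noteq> []" "l v + sum_list (map \<tau> p) \<le> l v" by blast
  with sum_list_travel_time_closed_walk_pos[OF p(1,2)] show False by simp
qed

end

section \<open>Right-continuous equilibria\<close>

lemma right_smooth_linear:
  assumes "right_smooth f f'" "right_smooth g g'"
  shows "right_smooth (\<lambda>x. f x + c * g x + b) (\<lambda>x. f' x + c * g' x)"
  using assms unfolding right_smooth_def
  by (auto intro!: continuous_intros derivative_eq_intros)

lemma right_smooth_mono:
  assumes "right_smooth f f'" "\<And>x. 0 \<le> f' x"
  shows "mono f"
proof (rule monoI)
  fix a b :: real assume "a \<le> b"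
  have "0 * (b - a) \<le> f b - f a"
    using assms by (intro increment_ge_of_right_derivative \<open>a \<le> b\<close>)
      (auto simp: right_smooth_def intro: continuous_on_subset)
  thus "f a \<le> f b" by simp
qed

lemma right_smooth_increment_eq:
  assumes "right_smooth f f'" "a \<le> b" "\<And>x. a \<le> x \<Longrightarrow> x < b \<Longrightarrow> f' x = c"
  shows "f b - f a = c * (b - a)"
proof (rule increment_eq_of_right_derivative[OF assms(2)])
  show "continuous_on {a..b} f" using assms(1) by (auto simp: right_smooth_def intro: continuous_on_subset)
  fix x assume "a \<le> x" "x < b"
  thus "(f has_real_derivative c) (at_right x)"
    using assms(1) assms(3)[of x] by (auto simp: right_smooth_def)
qed

lemma right_smooth_tendsto:
  assumes "right_smooth f f'"
  shows "(f \<longlongrightarrow> f x) (at_right x)"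
  using assms continuous_on_eq_continuous_at continuous_at_imp_continuous_at_within
  unfolding right_smooth_def continuous_within by blast

lemma continuous_nonneg_of_AE:
  fixes f :: "real \<Rightarrow> real"
  assumes "continuous_on UNIV f" "AE x in lebesgue. 0 \<le> f x"
  shows "0 \<le> f x"
proof (rule right_limit_le_of_AE[of x "x + 1" "\<lambda>_. 0" f])
  show "AE y in lebesgue. x < y \<and> y < x + 1 \<longrightarrow> 0 \<le> f y"
    using assms(2) by eventually_elim auto
  show "continuous (at_right x) f"
    using assms(1) continuous_on_eq_continuous_at continuous_at_imp_continuous_at_within by blast
qed auto

text \<open>Right-continuity of \<open>u\<close> is the consequence of piecewise constancy that lets
  flow conservation hold at every time.\<close>

locale right_continuous_equilibrium = flow_network G \<nu> \<tau> s t
  for G :: "('v, 'e) pre_digraph" (structure) and \<nu> \<tau> s t +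
  fixes u :: "real \<Rightarrow> real" and f :: "'e flow"
  assumes equilibrium: "dynamic_equilibrium u f"
    and right_continuous: "right_continuous_flow f"
    and inflow_right_continuous: "continuous (at_right x) u"
begin

abbreviation "p \<equiv> fst f"
abbreviation "m \<equiv> snd f"
abbreviation "P e \<equiv> cumulative (p e)"
abbreviation "M e \<equiv> cumulative (m e)"
abbreviation "z \<equiv> queue f"
abbreviation "T \<equiv> exit_time f"
abbreviation "l \<equiv> earliest_time f"

lemma feasible_flow: "feasible_flow_over_time u f"
  using equilibrium by (simp add: dynamic_equilibrium_def)

lemma rates_F0: "e \<in> arcs G \<Longrightarrow> p e \<in> F0" "e \<in> arcs G \<Longrightarrow> m e \<in> F0"
  using feasible_flow by (auto simp: feasible_flow_over_time_def)

lemma rates_nonneg: "e \<in> arcs G \<Longrightarrow> 0 \<le> p e x" "e \<in> arcs G \<Longrightarrow> 0 \<le> m e x"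
  using rates_F0 by (auto simp: F0_def)

lemma rates_right_continuous:
  "e \<in> arcs G \<Longrightarrow> continuous (at_right x) (p e)" "e \<in> arcs G \<Longrightarrow> continuous (at_right x) (m e)"
  using right_continuous by (auto simp: right_continuous_flow_def)

lemma P_smooth: "e \<in> arcs G \<Longrightarrow> right_smooth (P e) (p e)"
  and M_smooth: "e \<in> arcs G \<Longrightarrow> right_smooth (M e) (m e)"
  by (simp_all add: right_smooth_cumulative rates_F0 rates_right_continuous)

lemma M_mono: "e \<in> arcs G \<Longrightarrow> x \<le> y \<Longrightarrow> M e x \<le> M e y"
  using right_smooth_mono[OF M_smooth rates_nonneg(2)] by (auto dest: monoD)

lemma F0_right_continuous_early:
  assumes "g \<in> F0" "\<And>x. continuous (at_right x) g" "x < 0"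
  shows "g x = 0"
proof (rule right_limit_eq_of_AE[of x 0 g "\<lambda>_. 0"])
  have "AE y in lebesgue. y < 0 \<longrightarrow> g y = 0" using assms(1) by (simp add: F0_def)
  thus "AE y in lebesgue. x < y \<and> y < 0 \<longrightarrow> g y = 0" by eventually_elim auto
qed (use assms in auto)

lemma cumulative_early:
  assumes "g \<in> F0" "\<And>x. continuous (at_right x) g" "x \<le> 0"
  shows "cumulative g x = 0"
  using right_smooth_increment_eq[OF right_smooth_cumulative[OF assms(1,2)] assms(3), of 0]
    F0_right_continuous_early[OF assms(1,2)] by simp

lemma P_early: "e \<in> arcs G \<Longrightarrow> x \<le> 0 \<Longrightarrow> P e x = 0"
  and M_early: "e \<in> arcs G \<Longrightarrow> x \<le> 0 \<Longrightarrow> M e x = 0"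
  by (simp_all add: cumulative_early rates_F0 rates_right_continuous)

lemma M_nonneg: "e \<in> arcs G \<Longrightarrow> 0 \<le> M e x"
  using M_mono[of e "min 0 x" x] M_early[of e "min 0 x"] by simp

lemma feasible_AE:
  "AE \<theta> in lebesgue.
     (\<forall>e\<in>arcs G. m e \<theta> \<le> \<nu> e \<and> 0 \<le> z e \<theta>) \<and>
     (\<forall>v\<in>verts G - {t}. (\<Sum>e\<in>out_arcs G v. p e \<theta>) - (\<Sum>e\<in>in_arcs G v. m e \<theta>) = (if v = s then u \<theta> else 0))"
  using feasible_flow by (simp add: feasible_flow_over_time_def feasible_def)

lemma m_le:
  assumes e: "e \<in> arcs G"
  shows "m e x \<le> \<nu> e"
proof (rule right_limit_le_of_AE[of x "x + 1"])
  show "AE y in lebesgue. x < y \<and> y < x + 1 \<longrightarrow> m e y \<le> \<nu> e"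
    using feasible_AE by eventually_elim (use e in auto)
qed (auto simp: rates_right_continuous e)

lemma conservation:
  assumes "v \<in> verts G - {t}"
  shows "(\<Sum>e\<in>out_arcs G v. p e x) - (\<Sum>e\<in>in_arcs G v. m e x) = (if v = s then u x else 0)"
proof (rule right_limit_eq_of_AE[of x "x + 1"])
  show "AE y in lebesgue. x < y \<and> y < x + 1 \<longrightarrow>
    (\<Sum>e\<in>out_arcs G v. p e y) - (\<Sum>e\<in>in_arcs G v. m e y) = (if v = s then u y else 0)"
    using feasible_AE by eventually_elim (use assms in auto)
  show "continuous (at_right x) (\<lambda>x. (\<Sum>e\<in>out_arcs G v. p e x) - (\<Sum>e\<in>in_arcs G v. m e x))"
    by (intro continuous_intros rates_right_continuous) auto
  show "continuous (at_right x) (\<lambda>x. if v = s then u x else 0)"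
    by (cases "v = s") (simp_all add: inflow_right_continuous)
qed simp

section \<open>Queue and exit time of a single edge\<close>

lemma z_smooth:
  assumes "e \<in> arcs G"
  shows "right_smooth (z e) (\<lambda>x. p e x - m e (x + \<tau> e))"
proof -
  \<comment> \<open>The shift by \<open>\<tau> e\<close>, written as the case \<open>c = 0\<close>
    of \<open>right_smooth_linear\<close>.\<close>
  have "right_smooth (\<lambda>x. x + 0 * x + \<tau> e) (\<lambda>x. 1 + 0 * 1)"
    by (intro right_smooth_linear right_smooth_ident)
  hence "right_smooth (\<lambda>x. M e (x + 0 * x + \<tau> e)) (\<lambda>x. m e (x + 0 * x + \<tau> e) * (1 + 0 * 1))"
    by (intro right_smooth_compose M_smooth assms) (auto simp: mono_def)
  from right_smooth_linear[OF P_smooth[OF assms] this, of "-1" 0] show ?thesis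
    by (simp add: queue_def[abs_def])
qed

lemma T_smooth:
  assumes "e \<in> arcs G"
  shows "right_smooth (T e) (\<lambda>x. 1 + (p e x - m e (x + \<tau> e)) / \<nu> e)"
  using right_smooth_linear[OF right_smooth_ident z_smooth[OF assms], of "1 / \<nu> e" "\<tau> e"]
  by (simp add: exit_time_def[abs_def])

lemma z_nonneg:
  assumes "e \<in> arcs G"
  shows "0 \<le> z e x"
proof (rule continuous_nonneg_of_AE[of "z e"])
  show "continuous_on UNIV (z e)" using z_smooth[OF assms] by (simp add: right_smooth_def)
  show "AE x in lebesgue. 0 \<le> z e x" using feasible_AE by eventually_elim (use assms in auto)
qed

text \<open>First in, first out: the queue drains at rate at most \<open>\<nu> e\<close>, so waiting
  times decrease with slope at least \<open>-1\<close>.\<close>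

lemma T_mono:
  assumes "e \<in> arcs G"
  shows "mono (T e)"
proof (rule right_smooth_mono[OF T_smooth[OF assms]])
  fix x
  have "0 < \<nu> e" "m e (x + \<tau> e) \<le> \<nu> e" "0 \<le> p e x"
    using assms service_rate_pos m_le rates_nonneg by auto
  thus "0 \<le> 1 + (p e x - m e (x + \<tau> e)) / \<nu> e" by (simp add: field_simps)
qed

lemma T_ge: "e \<in> arcs G \<Longrightarrow> x + \<tau> e \<le> T e x"
  using z_nonneg[of e x] service_rate_pos[of e] by (simp add: exit_time_def)

lemma T_ge_self: "e \<in> arcs G \<Longrightarrow> x \<le> T e x"
  using T_ge[of e x] travel_time_nonneg[of e] by simp

lemma T_early:
  assumes "e \<in> arcs G" "x \<le> 0"
  shows "T e x = x + \<tau> e"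
proof -
  have "z e x \<le> 0" using P_early[OF assms] M_nonneg[OF assms(1), of "x + \<tau> e"] by (simp add: queue_def)
  hence "z e x = 0" using z_nonneg[OF assms(1), of x] by simp
  thus ?thesis by (simp add: exit_time_def)
qed

text \<open>Positivity is asked for only after \<open>a\<close>, so that the lemma also covers the
  moment at which a queue starts to grow.\<close>

lemma outflow_at_capacity:
  assumes "e \<in> arcs G" "a < b" "\<And>y. a < y \<Longrightarrow> y < b \<Longrightarrow> 0 < z e y"
  shows "m e (a + \<tau> e) = \<nu> e"
proof (rule right_limit_eq_of_AE[of a b "\<lambda>x. m e (x + \<tau> e)" "\<lambda>_. \<nu> e"])
  have "AE \<theta> in lebesgue. m e (\<theta> + \<tau> e) = (if 0 < z e \<theta> then \<nu> e else min (p e \<theta>) (\<nu> e))"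
    using feasible_flow assms(1) by (simp add: feasible_flow_over_time_def queues_at_capacity_def)
  thus "AE x in lebesgue. a < x \<and> x < b \<longrightarrow> m e (x + \<tau> e) = \<nu> e"
    by eventually_elim (use assms(3) in auto)
  have "(m e \<longlongrightarrow> m e (a + \<tau> e)) (at_right (a + \<tau> e))"
    using rates_right_continuous(2)[OF assms(1)] by (simp add: continuous_within)
  thus "continuous (at_right a) (\<lambda>x. m e (x + \<tau> e))"
    by (simp add: continuous_within filterlim_at_right_to_0[of _ _ a] filterlim_at_right_to_0[of _ _ "a + \<tau> e"] add_ac)
qed (use assms(2) in auto)

lemma outflow_of_positive_queue:
  assumes "e \<in> arcs G" "0 < z e x"
  shows "m e (x + \<tau> e) = \<nu> e"
proof -
  have "eventually (\<lambda>y. 0 < z e y) (at_right x)"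
    using right_smooth_tendsto[OF z_smooth[OF assms(1)]] assms(2) by (rule order_tendstoD(1))
  then obtain b where "x < b" "\<And>y. x < y \<Longrightarrow> y < b \<Longrightarrow> 0 < z e y"
    unfolding eventually_at_right_field by blast
  with outflow_at_capacity[OF assms(1)] show ?thesis by blast
qed

text \<open>The queue met at \<open>x\<close> shrinks at rate at most \<open>\<nu> e\<close> and
  takes the time \<open>T e x - x - \<tau> e\<close> to empty at that rate, so it is still positive
  when the flow leaving at \<open>y\<close> is released.\<close>

lemma outflow_while_emptying:
  assumes e: "e \<in> arcs G" and y: "x + \<tau> e \<le> y" "y < T e x"
  shows "m e y = \<nu> e"
proof -
  have nu: "0 < \<nu> e" using e service_rate_pos by blast
  define y' where "y' = y - \<tau> e"
  have "x \<le> y'" using y(1) by (simp add: y'_def)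
  have "- \<nu> e * (y' - x) \<le> z e y' - z e x"
  proof (rule increment_ge_of_right_derivative[OF \<open>x \<le> y'\<close>])
    show "continuous_on {x..y'} (z e)"
      using z_smooth[OF e] by (auto simp: right_smooth_def intro: continuous_on_subset)
    fix w
    have "- \<nu> e \<le> p e w - m e (w + \<tau> e)" using rates_nonneg(1)[OF e, of w] m_le[OF e, of "w + \<tau> e"] by simp
    thus "\<exists>D\<ge>- \<nu> e. (z e has_real_derivative D) (at_right w)"
      using z_smooth[OF e] unfolding right_smooth_def by blast
  qed
  moreover have "\<nu> e * (y' - x) < z e x"
    using y(2) nu by (simp add: y'_def exit_time_def field_simps)
  ultimately have "0 < z e y'" by simp
  thus ?thesis using outflow_of_positive_queue[OF e, of y'] by (simp add: y'_def)
qed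

lemma M_T_minus:
  assumes e: "e \<in> arcs G" and y: "x + \<tau> e \<le> y" "y \<le> T e x"
  shows "M e (T e x) - M e y = \<nu> e * (T e x - y)"
  by (rule right_smooth_increment_eq[OF M_smooth[OF e] y(2)])
    (use y(1) in \<open>auto intro: outflow_while_emptying[OF e, of x]\<close>)

text \<open>What is in the queue at \<open>x\<close> leaves at rate \<open>\<nu> e\<close> exactly
  between \<open>x + \<tau> e\<close> and \<open>T e x\<close>.\<close>

lemma M_T:
  assumes "e \<in> arcs G"
  shows "M e (T e x) = P e x"
  using M_T_minus[OF assms order.refl T_ge[OF assms]] service_rate_pos[OF assms]
  by (simp add: exit_time_def queue_def field_simps)

text \<open>The queue size is at its minimum \<open>0\<close>, so its right derivative is
  nonnegative.\<close>

lemma outflow_le_inflow_of_empty_queue: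
  assumes e: "e \<in> arcs G" and "z e x = 0"
  shows "m e (x + \<tau> e) \<le> p e x"
proof -
  have "0 \<le> p e x - m e (x + \<tau> e)"
    by (rule right_derivative_le[of "\<lambda>_. 0" _ x "z e"])
      (use z_smooth[OF e] z_nonneg[OF e] assms(2) in \<open>auto simp: right_smooth_def\<close>)
  thus ?thesis by simp
qed

text \<open>Either outflow equals inflow and the slope is \<open>1\<close>, or a queue builds up
  just after \<open>x\<close>; then the outflow is \<open>\<nu> e\<close> and the slope is
  \<open>p e x / \<nu> e\<close>.\<close>

lemma T_slope_of_empty_queue:
  assumes e: "e \<in> arcs G" and "z e x = 0"
  shows "1 + (p e x - m e (x + \<tau> e)) / \<nu> e \<le> max 1 (p e x / \<nu> e)"
proof (cases "m e (x + \<tau> e) = p e x")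
  case False
  hence pos: "0 < p e x - m e (x + \<tau> e)" using outflow_le_inflow_of_empty_queue[OF assms] by simp
  have "(z e has_real_derivative p e x - m e (x + \<tau> e)) (at_right x)"
    using z_smooth[OF e] by (simp add: right_smooth_def)
  then obtain d where d: "d > 0" "\<And>h. h > 0 \<Longrightarrow> x + h \<in> {x<..} \<Longrightarrow> h < d \<Longrightarrow> z e x < z e (x + h)"
    using has_real_derivative_pos_inc_right[OF _ pos] by blast
  have "0 < z e y" if "x < y" "y < x + d" for y
    using d(2)[of "y - x"] that assms(2) by auto
  hence "m e (x + \<tau> e) = \<nu> e"
    using d(1) by (intro outflow_at_capacity[OF e, of x "x + d"]) auto
  thus ?thesis using service_rate_pos[OF e] by (simp add: diff_divide_distrib)
qed simp

end

section \<open>Arrival times along paths and earliest times\<close>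

context flow_network
begin

lemma travel_time_apath_le:
  assumes "apath v Q w"
  shows "sum_list (map \<tau> Q) \<le> sum \<tau> (arcs G)"
proof -
  have "awalk v Q w" using assms by (rule awalkI_apath)
  hence "distinct Q" "set Q \<subseteq> arcs G"
    using assms distinct_verts_imp_distinct by (auto simp: apath_def awalk_def)
  thus ?thesis
    by (auto simp: sum_list_distinct_conv_sum_set travel_time_nonneg intro!: sum_mono2)
qed

lemma apath_exists: "w \<in> verts G \<Longrightarrow> \<exists>Q. apath s Q w"
  using reachable_from_source reachable_awalk apath_awalk_to_apath by blast

lemma path_arrival_simps [simp]:
  "path_arrival f [] x = x"
  "path_arrival f (e # Q) x = path_arrival f Q (exit_time f e x)"
  "path_arrival f (Q @ R) x = path_arrival f R (path_arrival f Q x)"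
  by (simp_all add: path_arrival_def)

end

context right_continuous_equilibrium
begin

lemma path_arrival_mono: "set Q \<subseteq> arcs G \<Longrightarrow> mono (path_arrival f Q)"
  by (induction Q) (auto simp: mono_def dest: monoD[OF T_mono])

lemma path_arrival_ge: "set Q \<subseteq> arcs G \<Longrightarrow> x \<le> path_arrival f Q x"
proof (induction Q arbitrary: x)
  case (Cons e Q)
  thus ?case using T_ge_self[of e x] Cons.IH[of "T e x"] by (auto intro: order_trans)
qed simp

lemma path_arrival_smooth: "set Q \<subseteq> arcs G \<Longrightarrow> \<exists>f'. right_smooth (path_arrival f Q) f'"
proof (induction Q)
  case Nil
  thus ?case using right_smooth_ident by (auto simp: path_arrival_def id_def)
next
  case (Cons e Q)
  then obtain f' where "right_smooth (path_arrival f Q) f'" by auto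
  from right_smooth_compose[OF T_mono T_smooth this] Cons.prems show ?case
    by (auto simp: path_arrival_def o_def)
qed

lemma path_arrival_early:
  "set Q \<subseteq> arcs G \<Longrightarrow> x + sum_list (map \<tau> Q) \<le> 0 \<Longrightarrow> path_arrival f Q x = x + sum_list (map \<tau> Q)"
proof (induction Q arbitrary: x)
  case (Cons e Q)
  have "0 \<le> \<tau> e" "0 \<le> sum_list (map \<tau> Q)"
    using Cons.prems(1) travel_time_nonneg by (auto 0 3 intro!: sum_list_nonneg)
  with Cons T_early[of e x] show ?case by (simp add: add_ac)
qed simp

lemma earliest_time_le_apath: "apath s Q w \<Longrightarrow> l w x \<le> path_arrival f Q x"
  unfolding earliest_time_def by (intro Min_le) (auto simp: apaths_finite)

lemma earliest_time_attained:
  assumes "w \<in> verts G"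
  obtains Q where "apath s Q w" "l w x = path_arrival f Q x"
proof -
  have "l w x \<in> (\<lambda>Q. path_arrival f Q x) ` {Q. apath s Q w}"
    unfolding earliest_time_def using apath_exists[OF assms] by (intro Min_in) (auto simp: apaths_finite)
  thus thesis using that by auto
qed

lemma awalk_arcs: "awalk v Q w \<Longrightarrow> set Q \<subseteq> arcs G"
  by (simp add: awalk_def)

lemma apath_arcs: "apath v Q w \<Longrightarrow> set Q \<subseteq> arcs G"
  by (auto dest: awalkI_apath awalk_arcs)

text \<open>Removing a cycle from a walk does not delay the arrival, since \<open>x \<le> T e x\<close>.\<close>

lemma earliest_time_le_awalk: "awalk s Q w \<Longrightarrow> l w x \<le> path_arrival f Q x"
proof (induction rule: awalk_to_apath_induct)
  case (path Q)
  thus ?case by (intro earliest_time_le_apath) (simp add: apath_def)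
next
  case (decomp Q q r q')
  have Q: "Q = q @ r @ q'" using awalk_cyc_decompE[OF decomp(2) decomp(1,3)] by blast
  hence arcs: "set q \<subseteq> arcs G" "set r \<subseteq> arcs G" "set q' \<subseteq> arcs G"
    using awalk_arcs[OF decomp(1)] by auto
  have "path_arrival f q' (path_arrival f q x) \<le> path_arrival f q' (path_arrival f r (path_arrival f q x))"
    using arcs by (intro monoD[OF path_arrival_mono] path_arrival_ge)
  with decomp(4) show ?case by (simp add: Q)
qed

lemma earliest_time_source: "l s x = x"
proof (rule antisym)
  have "apath s [] s" using source_in_verts by (simp add: apath_Nil_iff)
  from earliest_time_le_apath[OF this] show "l s x \<le> x" by simp
  obtain Q where "apath s Q s" "l s x = path_arrival f Q x"
    using earliest_time_attained source_in_verts by blast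
  thus "x \<le> l s x" using path_arrival_ge[OF apath_arcs] by auto
qed

lemma earliest_time_mono:
  assumes "w \<in> verts G"
  shows "mono (l w)"
proof (rule monoI)
  fix x y :: real assume "x \<le> y"
  obtain Q where Q: "apath s Q w" "l w y = path_arrival f Q y"
    using earliest_time_attained assms by blast
  have "l w x \<le> path_arrival f Q x" by (rule earliest_time_le_apath[OF Q(1)])
  also have "\<dots> \<le> path_arrival f Q y"
    by (rule monoD[OF path_arrival_mono[OF apath_arcs[OF Q(1)]] \<open>x \<le> y\<close>])
  finally show "l w x \<le> l w y" using Q(2) by simp
qed

lemma earliest_time_smooth:
  assumes "w \<in> verts G"
  shows "\<exists>l'. right_smooth (l w) l'"
  using right_smooth_Min[of "{Q. apath s Q w}" "path_arrival f"] apath_exists[OF assms]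
    path_arrival_smooth[OF apath_arcs]
  by (auto simp: earliest_time_def[abs_def] apaths_finite)

text \<open>Paths started this early end by time \<open>0\<close> and meet no queue. The value
  depends on the network alone, which gives the initial agreement of two equilibria.\<close>

lemma earliest_time_early:
  assumes "w \<in> verts G" "x \<le> - sum \<tau> (arcs G)"
  shows "l w x = Min ((\<lambda>Q. x + sum_list (map \<tau> Q)) ` {Q. apath s Q w})"
proof -
  have "path_arrival f Q x = x + sum_list (map \<tau> Q)" if "apath s Q w" for Q
    using path_arrival_early[OF apath_arcs[OF that], of x] travel_time_apath_le[OF that] assms(2) by simp
  hence "(\<lambda>Q. path_arrival f Q x) ` {Q. apath s Q w} = (\<lambda>Q. x + sum_list (map \<tau> Q)) ` {Q. apath s Q w}"
    by auto
  thus ?thesis by (simp add: earliest_time_def)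
qed

lemma earliest_time_nonpos_early:
  assumes "w \<in> verts G" "x \<le> - sum \<tau> (arcs G)"
  shows "l w x \<le> 0"
proof -
  obtain Q where Q: "apath s Q w" using apath_exists assms(1) by blast
  have "path_arrival f Q x = x + sum_list (map \<tau> Q)" "x + sum_list (map \<tau> Q) \<le> 0"
    using path_arrival_early[OF apath_arcs[OF Q], of x] travel_time_apath_le[OF Q] assms(2) by simp_all
  thus ?thesis using earliest_time_le_apath[OF Q, of x] by simp
qed

text \<open>Appending \<open>e\<close> to an optimal path may close a cycle, so the bound for walks
  is needed.\<close>

lemma earliest_time_head_le:
  assumes e: "e \<in> arcs G"
  shows "l (head G e) x \<le> T e (l (tail G e) x)"
proof -
  obtain Q where Q: "apath s Q (tail G e)" "l (tail G e) x = path_arrival f Q x"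
    using earliest_time_attained e tail_in_verts by blast
  have "awalk s Q (tail G e)" using Q(1) by (rule awalkI_apath)
  moreover have "awalk (tail G e) [e] (head G e)" using e by (rule arc_implies_awalk)
  ultimately have "awalk s (Q @ [e]) (head G e)" by auto
  from earliest_time_le_awalk[OF this, of x] show ?thesis by (simp add: Q(2))
qed

text \<open>The last edge of an optimal path works: its prefix need not be chosen optimal, but
  \<open>T e\<close> is monotone and the reverse inequality is
  \<open>earliest_time_head_le\<close>.\<close>

lemma earliest_time_predecessor:
  assumes w: "w \<in> verts G" "w \<noteq> s"
  shows "\<exists>e\<in>arcs G. head G e = w \<and> l w x = T e (l (tail G e) x)"
proof -
  obtain Q where Q: "apath s Q w" "l w x = path_arrival f Q x"
    using earliest_time_attained w by blast
  have aw: "awalk s Q w" using Q(1) by (rule awalkI_apath)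
  have "Q \<noteq> []" using Q(1) w(2) by (auto simp: apath_Nil_iff)
  then obtain R e where R: "Q = R @ [e]" by (metis rev_exhaust)
  have e: "e \<in> arcs G" "head G e = w" and R': "awalk s R (tail G e)"
    using aw by (auto simp: R awalk_Cons_iff awalk_Nil_iff)
  have "T e (l (tail G e) x) \<le> T e (path_arrival f R x)"
    by (intro monoD[OF T_mono] e earliest_time_le_awalk R')
  also have "\<dots> = l w x" by (simp add: Q(2) R)
  finally have "l w x = T e (l (tail G e) x)" using earliest_time_head_le[OF e(1), of x] e(2) by simp
  with e show ?thesis by blast
qed

section \<open>The equilibrium condition in integrated form\<close>

lemma no_inflow_while_inactive:
  assumes e: "e \<in> arcs G" and "a \<le> b"
    and inact: "\<And>y. a < y \<Longrightarrow> y \<le> b \<Longrightarrow> l (head G e) y < T e (l (tail G e) y)"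
  shows "P e (l (tail G e) b) = P e (l (tail G e) a)"
proof -
  let ?v = "tail G e"
  have v: "?v \<in> verts G" using e by simp
  have le: "l ?v a \<le> l ?v b" using monoD[OF earliest_time_mono[OF v]] \<open>a \<le> b\<close> by blast
  have cont: "continuous_on UNIV (l ?v)" using earliest_time_smooth[OF v] by (auto simp: right_smooth_def)
  have AE: "AE \<xi> in lebesgue. \<xi> \<in> l ?v ` (UNIV - active_times f e) \<longrightarrow> p e \<xi> = 0"
    using equilibrium e by (simp add: dynamic_equilibrium_def)
  have "P e (l ?v b) - P e (l ?v a) = 0 * (l ?v b - l ?v a)"
  proof (rule right_smooth_increment_eq[OF P_smooth[OF e] le])
    fix y assume y: "l ?v a \<le> y" "y < l ?v b"
    show "p e y = 0"
    proof (rule right_limit_eq_of_AE[of y "l ?v b" "p e" "\<lambda>_. 0"])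
      show "AE \<xi> in lebesgue. y < \<xi> \<and> \<xi> < l ?v b \<longrightarrow> p e \<xi> = 0"
        using AE
      proof eventually_elim
        case (elim \<xi>)
        show ?case
        proof
          assume \<xi>: "y < \<xi> \<and> \<xi> < l ?v b"
          \<comment> \<open>Continuity of the earliest time makes every entry time in the range the
            image of some time in \<open>{a..b}\<close>. Since \<open>\<xi>\<close> exceeds the
            value at \<open>a\<close>, that time is not \<open>a\<close>, where the edge is allowed
            to be active.\<close>
          obtain \<theta> where \<theta>: "a \<le> \<theta>" "\<theta> \<le> b" "l ?v \<theta> = \<xi>"
            using IVT'[of "l ?v" a \<xi> b] \<xi> y(1) \<open>a \<le> b\<close> continuous_on_subset[OF cont] by auto
          have "\<theta> \<noteq> a" using \<theta>(3) \<xi> y(1) by auto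
          with \<theta> inact[of \<theta>] have "\<theta> \<in> UNIV - active_times f e" by (simp add: active_times_def)
          with elim \<theta>(3) show "p e \<xi> = 0" by blast
        qed
      qed
    qed (use y(2) rates_right_continuous[OF e] in auto)
  qed
  thus ?thesis by simp
qed

text \<open>One inequality is first in, first out. For the other, go back to the last active time:
  nothing has entered since, and at that time what has entered has left by the earliest time at the
  head.\<close>

lemma inflow_eq_outflow:
  assumes e: "e \<in> arcs G"
  shows "P e (l (tail G e) x) = M e (l (head G e) x)"
proof (rule antisym)
  let ?v = "tail G e" and ?w = "head G e"
  have v: "?v \<in> verts G" and w: "?w \<in> verts G" using e by auto
  show "M e (l ?w x) \<le> P e (l ?v x)"
    using M_mono[OF e earliest_time_head_le[OF e, of x]] M_T[OF e] by simp
  define K where "K = {y. T e (l ?v y) \<le> l ?w y} \<inter> {..x}"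
  have "continuous_on UNIV (\<lambda>y. T e (l ?v y))" "continuous_on UNIV (l ?w)"
    using earliest_time_smooth[OF v] earliest_time_smooth[OF w] T_smooth[OF e]
    by (auto simp: right_smooth_def intro: continuous_on_compose2)
  hence "closed K" unfolding K_def by (intro closed_Int closed_Collect_le) auto
  show "P e (l ?v x) \<le> M e (l ?w x)"
  proof (cases "K = {}")
    case True
    \<comment> \<open>Early enough for the earliest time at the tail to be nonpositive, when nothing
      has entered the edge.\<close>
    define a where "a = min x (- sum \<tau> (arcs G))"
    have "P e (l ?v x) = P e (l ?v a)"
      by (rule no_inflow_while_inactive[OF e]) (use True in \<open>auto simp: a_def K_def not_le[symmetric]\<close>)
    also have "\<dots> = 0"
      using earliest_time_nonpos_early[OF v] by (intro P_early[OF e]) (simp add: a_def)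
    finally show ?thesis using M_nonneg[OF e] by simp
  next
    case False
    have bdd: "bdd_above K" unfolding K_def by (rule bdd_above_Int2) simp
    define a where "a = Sup K"
    have "a \<in> K" unfolding a_def using False bdd \<open>closed K\<close> by (rule closed_contains_Sup)
    have a: "T e (l ?v a) \<le> l ?w a" "a \<le> x" using \<open>a \<in> K\<close> by (auto simp: K_def)
    have "P e (l ?v x) = P e (l ?v a)"
    proof (rule no_inflow_while_inactive[OF e a(2)])
      fix y assume "a < y" "y \<le> x"
      hence "y \<notin> K" using cSup_upper[OF _ bdd] by (force simp: a_def)
      thus "l ?w y < T e (l ?v y)" using \<open>y \<le> x\<close> by (auto simp: K_def)
    qed
    also have "\<dots> = M e (T e (l ?v a))" using M_T[OF e] by simp
    also have "\<dots> \<le> M e (l ?w a)" by (rule M_mono[OF e a(1)])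
    also have "\<dots> \<le> M e (l ?w x)"
      by (intro M_mono[OF e] monoD[OF earliest_time_mono[OF w]] a(2))
    finally show ?thesis .
  qed
qed

text \<open>On an inactive edge \<open>M e\<close> would be constant between
  \<open>l (head G e) x\<close> and the later exit time, while the queue discharges at positive rate
  just before that exit time.\<close>

lemma queue_active:
  assumes e: "e \<in> arcs G" and "0 < z e (l (tail G e) x)"
  shows "T e (l (tail G e) x) = l (head G e) x"
proof (rule ccontr)
  let ?v = "tail G e" and ?w = "head G e"
  assume "T e (l ?v x) \<noteq> l ?w x"
  hence lt: "l ?w x < T e (l ?v x)" using earliest_time_head_le[OF e, of x] by simp
  have nu: "0 < \<nu> e" using e service_rate_pos by blast
  \<comment> \<open>Late enough to lie after both the earliest time at the head and the start of the
    discharge.\<close>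
  define y where "y = max (l ?w x) (l ?v x + \<tau> e)"
  have y: "l ?v x + \<tau> e \<le> y" "y < T e (l ?v x)"
    using lt assms(2) nu by (auto simp: y_def exit_time_def)
  have "M e (T e (l ?v x)) = M e (l ?w x)" using M_T[OF e] inflow_eq_outflow[OF e] by simp
  also have "\<dots> \<le> M e y" by (intro M_mono[OF e]) (simp add: y_def)
  finally show False using M_T_minus[OF e y(1) less_imp_le[OF y(2)]] mult_pos_pos[OF nu, of "T e (l ?v x) - y"] y(2) by simp
qed

end

section \<open>Slopes of the earliest-time functions form a thin flow\<close>

context flow_network
begin

text \<open>For \<open>k v\<close> the earliest time at \<open>v\<close> in an equilibrium, these are the active edges and the
  edges with a queue.\<close>

definition tight_arcs :: "('v \<Rightarrow> real) \<Rightarrow> 'e set" where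
  "tight_arcs k = {e \<in> arcs G. k (tail G e) + \<tau> e \<le> k (head G e)}"

definition queueing_arcs :: "('v \<Rightarrow> real) \<Rightarrow> 'e set" where
  "queueing_arcs k = {e \<in> arcs G. k (tail G e) + \<tau> e < k (head G e)}"

end

context right_continuous_equilibrium
begin

definition slope :: "'v \<Rightarrow> real \<Rightarrow> real" where
  "slope v = (SOME l'. right_smooth (l v) l')"

lemma slope_smooth: "v \<in> verts G \<Longrightarrow> right_smooth (l v) (slope v)"
  unfolding slope_def using earliest_time_smooth by (rule someI_ex)

lemma slope_deriv: "v \<in> verts G \<Longrightarrow> (l v has_real_derivative slope v x) (at_right x)"
  using slope_smooth by (simp add: right_smooth_def)

lemma slope_nonneg:
  assumes "v \<in> verts G"
  shows "0 \<le> slope v x"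
  by (rule right_derivative_le[of "\<lambda>_. l v x" _ x "l v"])
    (use slope_deriv[OF assms] monoD[OF earliest_time_mono[OF assms]] in auto)

lemma slope_source: "slope s x = 1"
proof (rule right_derivative_unique)
  show "(l s has_real_derivative slope s x) (at_right x)" by (rule slope_deriv[OF source_in_verts])
  have "l s = (\<lambda>x. x)" by (simp add: fun_eq_iff earliest_time_source)
  thus "(l s has_real_derivative 1) (at_right x)" by (auto intro!: derivative_eq_intros)
qed

text \<open>The flow on \<open>e\<close> per unit of departure time at the source; by the chain rule
  it is the right derivative of \<open>P e (l (tail G e) x)\<close>.\<close>

definition arc_flow :: "'e \<Rightarrow> real \<Rightarrow> real" where
  "arc_flow e x = p e (l (tail G e) x) * slope (tail G e) x"

lemma right_derivative_along_earliest_time: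
  assumes "v \<in> verts G" "right_smooth g g'"
  shows "((\<lambda>x. g (l v x)) has_real_derivative g' (l v x) * slope v x) (at_right x)"
  using assms by (intro right_derivative_compose earliest_time_mono slope_deriv) (auto simp: right_smooth_def)

lemma arc_flow_deriv:
  assumes "e \<in> arcs G"
  shows "((\<lambda>x. P e (l (tail G e) x)) has_real_derivative arc_flow e x) (at_right x)"
  unfolding arc_flow_def using assms by (intro right_derivative_along_earliest_time P_smooth) auto

lemma arc_flow_eq_outflow:
  assumes e: "e \<in> arcs G"
  shows "arc_flow e x = m e (l (head G e) x) * slope (head G e) x"
proof (rule right_derivative_unique[OF arc_flow_deriv[OF e]])
  show "((\<lambda>x. P e (l (tail G e) x)) has_real_derivative m e (l (head G e) x) * slope (head G e) x) (at_right x)"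
    unfolding inflow_eq_outflow[OF e]
    using e by (intro right_derivative_along_earliest_time M_smooth) auto
qed

lemma exit_deriv:
  assumes "e \<in> arcs G"
  shows "((\<lambda>x. T e (l (tail G e) x)) has_real_derivative
    (1 + (p e (l (tail G e) x) - m e (l (tail G e) x + \<tau> e)) / \<nu> e) * slope (tail G e) x) (at_right x)"
  using right_derivative_along_earliest_time[OF _ T_smooth[OF assms]] assms by simp

lemma earliest_time_tendsto: "v \<in> verts G \<Longrightarrow> (l v \<longlongrightarrow> l v x) (at_right x)"
  by (rule right_smooth_tendsto[OF slope_smooth])

lemma queue_of_queueing_arc:
  assumes "e \<in> queueing_arcs (\<lambda>v. l v x)"
  shows "0 < z e (l (tail G e) x)"
proof -
  have e: "e \<in> arcs G" and lt: "l (tail G e) x + \<tau> e < l (head G e) x"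
    using assms by (auto simp: queueing_arcs_def)
  hence "0 < z e (l (tail G e) x) / \<nu> e"
    using earliest_time_head_le[OF e, of x] by (simp add: exit_time_def)
  thus ?thesis using service_rate_pos[OF e] by (simp add: zero_less_divide_iff)
qed

lemma queue_of_tight_not_queueing_arc:
  assumes "e \<in> tight_arcs (\<lambda>v. l v x)" "e \<notin> queueing_arcs (\<lambda>v. l v x)"
  shows "z e (l (tail G e) x) = 0" "l (head G e) x = l (tail G e) x + \<tau> e"
proof -
  have e: "e \<in> arcs G" and eq: "l (head G e) x = l (tail G e) x + \<tau> e"
    using assms by (auto simp: queueing_arcs_def tight_arcs_def)
  show "l (head G e) x = l (tail G e) x + \<tau> e" by (rule eq)
  show "z e (l (tail G e) x) = 0"
  proof (rule ccontr)
    assume "z e (l (tail G e) x) \<noteq> 0"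
    hence pos: "0 < z e (l (tail G e) x)" using z_nonneg[OF e, of "l (tail G e) x"] by simp
    hence "0 < z e (l (tail G e) x) / \<nu> e" using service_rate_pos[OF e] by simp
    with queue_active[OF e pos] eq show False unfolding exit_time_def by linarith
  qed
qed

text \<open>By continuity the edge stays inactive just after \<open>x\<close>, so the cumulative
  inflow is constant there.\<close>

lemma arc_flow_not_tight:
  assumes e: "e \<in> arcs G" and "e \<notin> tight_arcs (\<lambda>v. l v x)"
  shows "arc_flow e x = 0"
proof -
  let ?v = "tail G e" and ?w = "head G e"
  have V: "?v \<in> verts G" "?w \<in> verts G" using e by auto
  have "((\<lambda>y. l ?v y + \<tau> e - l ?w y) \<longlongrightarrow> l ?v x + \<tau> e - l ?w x) (at_right x)"
    by (intro tendsto_intros earliest_time_tendsto V)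
  moreover have "0 < l ?v x + \<tau> e - l ?w x" using assms by (auto simp: tight_arcs_def)
  ultimately have "eventually (\<lambda>y. 0 < l ?v y + \<tau> e - l ?w y) (at_right x)" by (rule order_tendstoD(1))
  then obtain b where b: "x < b" "\<And>y. x < y \<Longrightarrow> y < b \<Longrightarrow> 0 < l ?v y + \<tau> e - l ?w y"
    unfolding eventually_at_right_field by blast
  have "P e (l ?v y) = P e (l ?v x)" if y: "x < y" "y < b" for y
  proof (rule no_inflow_while_inactive[OF e less_imp_le[OF y(1)]])
    fix y' assume "x < y'" "y' \<le> y"
    thus "l ?w y' < T e (l ?v y')" using b(2)[of y'] y T_ge[OF e, of "l ?v y'"] by simp
  qed
  hence "eventually (\<lambda>y. P e (l ?v y) = P e (l ?v x)) (at_right x)"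
    unfolding eventually_at_right_field using b(1) by blast
  hence "frequently (\<lambda>y. P e (l ?v y) = P e (l ?v x)) (at_right x)"
    by (rule eventually_frequently[rotated]) simp
  thus ?thesis
    by (intro right_derivative_cong_frequently[OF arc_flow_deriv[OF e], of "\<lambda>_. P e (l ?v x)" 0]) auto
qed

text \<open>The strict inequality persists just after \<open>x\<close>, so
  \<open>T e (l v y) = l w y\<close> can be differentiated; with outflow rate \<open>\<nu> e\<close>
  the slope of \<open>T e\<close> is \<open>p e / \<nu> e\<close>.\<close>

lemma slope_queueing:
  assumes q: "e \<in> queueing_arcs (\<lambda>v. l v x)"
  shows "\<nu> e * slope (head G e) x = arc_flow e x"
proof -
  let ?v = "tail G e" and ?w = "head G e"
  have e: "e \<in> arcs G" using q by (simp add: queueing_arcs_def)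
  have V: "?v \<in> verts G" "?w \<in> verts G" using e by auto
  have nu: "0 < \<nu> e" using e service_rate_pos by blast
  have "((\<lambda>y. l ?w y - (l ?v y + \<tau> e)) \<longlongrightarrow> l ?w x - (l ?v x + \<tau> e)) (at_right x)"
    by (intro tendsto_intros earliest_time_tendsto V)
  moreover have "0 < l ?w x - (l ?v x + \<tau> e)" using q by (auto simp: queueing_arcs_def)
  ultimately have "eventually (\<lambda>y. 0 < l ?w y - (l ?v y + \<tau> e)) (at_right x)" by (rule order_tendstoD(1))
  hence "eventually (\<lambda>y. T e (l ?v y) = l ?w y) (at_right x)"
  proof eventually_elim
    case (elim y)
    hence "e \<in> queueing_arcs (\<lambda>v. l v y)" using e by (simp add: queueing_arcs_def)
    thus ?case by (intro queue_active[OF e] queue_of_queueing_arc)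
  qed
  hence "frequently (\<lambda>y. T e (l ?v y) = l ?w y) (at_right x)"
    by (rule eventually_frequently[rotated]) simp
  moreover have "T e (l ?v x) = l ?w x" by (intro queue_active[OF e] queue_of_queueing_arc q)
  ultimately have "(1 + (p e (l ?v x) - m e (l ?v x + \<tau> e)) / \<nu> e) * slope ?v x = slope ?w x"
    using right_derivative_cong_frequently[OF exit_deriv[OF e] slope_deriv[OF V(2)]] by blast
  moreover have "m e (l ?v x + \<tau> e) = \<nu> e"
    by (intro outflow_of_positive_queue[OF e] queue_of_queueing_arc q)
  ultimately show ?thesis using nu by (simp add: arc_flow_def field_simps)
qed

text \<open>The bounds come from differentiating \<open>l w y \<le> T e (l v y)\<close>, which is an
  equality at \<open>x\<close>, from the service rate bound on the outflow, and from the outflow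
  rate being at most the inflow rate when there is no queue.\<close>

lemma slope_tight:
  assumes e: "e \<in> tight_arcs (\<lambda>v. l v x) - queueing_arcs (\<lambda>v. l v x)"
  shows "slope (head G e) x \<le> max (slope (tail G e) x) (arc_flow e x / \<nu> e)"
    and "arc_flow e x \<le> \<nu> e * slope (head G e) x"
    and "0 < arc_flow e x \<Longrightarrow> slope (tail G e) x \<le> slope (head G e) x"
proof -
  let ?v = "tail G e" and ?w = "head G e"
  have arc: "e \<in> arcs G" using e by (simp add: tight_arcs_def)
  have V: "?v \<in> verts G" "?w \<in> verts G" using arc by auto
  have nu: "0 < \<nu> e" using arc service_rate_pos by blast
  have z0: "z e (l ?v x) = 0" and eq: "l ?w x = l ?v x + \<tau> e"
    using queue_of_tight_not_queueing_arc e by blast+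
  have "slope ?w x \<le> (1 + (p e (l ?v x) - m e (l ?v x + \<tau> e)) / \<nu> e) * slope ?v x"
  proof (rule right_derivative_le[OF slope_deriv[OF V(2)] exit_deriv[OF arc]])
    show "l ?w x = T e (l ?v x)" using z0 eq by (simp add: exit_time_def)
  qed (rule earliest_time_head_le[OF arc])
  also have "\<dots> \<le> max 1 (p e (l ?v x) / \<nu> e) * slope ?v x"
    by (intro mult_right_mono T_slope_of_empty_queue arc z0 slope_nonneg V)
  also have "\<dots> = max (slope ?v x) (arc_flow e x / \<nu> e)"
    using slope_nonneg[OF V(1), of x] by (simp add: arc_flow_def max_mult_distrib_right)
  finally show "slope ?w x \<le> max (slope ?v x) (arc_flow e x / \<nu> e)" .
  have out: "arc_flow e x = m e (l ?w x) * slope ?w x" by (rule arc_flow_eq_outflow[OF arc])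
  show "arc_flow e x \<le> \<nu> e * slope ?w x"
    unfolding out by (intro mult_right_mono m_le arc slope_nonneg V)
  assume pos: "0 < arc_flow e x"
  show "slope ?v x \<le> slope ?w x"
  proof (rule ccontr)
    assume "\<not> ?thesis"
    moreover have "0 < m e (l ?w x)"
      using pos rates_nonneg(2)[OF arc, of "l ?w x"] by (auto simp: out less_le)
    ultimately have "m e (l ?w x) * slope ?w x < m e (l ?w x) * slope ?v x" by simp
    also have "\<dots> \<le> p e (l ?v x) * slope ?v x"
      using outflow_le_inflow_of_empty_queue[OF arc z0] eq slope_nonneg[OF V(1), of x]
      by (intro mult_right_mono) auto
    also have "\<dots> = arc_flow e x" by (simp add: arc_flow_def)
    finally show False by (simp add: out)
  qed
qed

text \<open>The minimising edge may change with time, but among the finitely many entering edges one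
  attains the minimum arbitrarily soon after \<open>x\<close>. This determines the value and the
  right derivative at \<open>x\<close>.\<close>

lemma slope_predecessor:
  assumes w: "w \<in> verts G - {s}"
  shows "\<exists>e\<in>tight_arcs (\<lambda>v. l v x). head G e = w \<and>
    (e \<in> queueing_arcs (\<lambda>v. l v x) \<or> slope (tail G e) x \<le> slope w x)"
proof -
  define Q where "Q e y \<longleftrightarrow> l w y = T e (l (tail G e) y)" for e y
  have "\<exists>e\<in>arcs G. head G e = w \<and> frequently (Q e) (at_right x)"
  proof (rule ccontr)
    assume "\<not> ?thesis"
    hence "\<forall>e\<in>in_arcs G w. eventually (\<lambda>y. \<not> Q e y) (at_right x)"
      by (auto simp: frequently_def)
    hence "eventually (\<lambda>y. \<forall>e\<in>in_arcs G w. \<not> Q e y) (at_right x)"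
      by (intro eventually_ball_finite) auto
    moreover have "\<not> (\<forall>e\<in>in_arcs G w. \<not> Q e y)" for y
      using earliest_time_predecessor[of w y] w by (auto simp: Q_def)
    ultimately show False by simp
  qed
  then obtain e where e: "e \<in> arcs G" "head G e = w" and fr: "frequently (Q e) (at_right x)" by blast
  let ?v = "tail G e"
  have V: "?v \<in> verts G" using e by simp
  have Tl: "((\<lambda>y. l w y - T e (l ?v y)) \<longlongrightarrow> l w x - T e (l ?v x)) (at_right x)"
  proof (intro tendsto_diff earliest_time_tendsto)
    have "isCont (T e) (l ?v x)"
      using T_smooth[OF e(1)] by (simp add: right_smooth_def continuous_on_eq_continuous_at)
    thus "((\<lambda>y. T e (l ?v y)) \<longlongrightarrow> T e (l ?v x)) (at_right x)"
      using earliest_time_tendsto[OF V] by (rule isCont_tendsto_compose)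
  qed (use w in auto)
  have eq: "l w x = T e (l ?v x)"
  proof (rule ccontr)
    assume "l w x \<noteq> T e (l ?v x)"
    hence "eventually (\<lambda>y. l w y - T e (l ?v y) \<noteq> 0) (at_right x)"
      using Tl by (intro tendsto_imp_eventually_ne) auto
    with fr show False by (simp add: frequently_def Q_def)
  qed
  have tight: "e \<in> tight_arcs (\<lambda>v. l v x)"
    using T_ge[OF e(1), of "l ?v x"] eq e by (simp add: tight_arcs_def)
  moreover have "slope ?v x \<le> slope w x" if nq: "e \<notin> queueing_arcs (\<lambda>v. l v x)"
  proof -
    have z0: "z e (l ?v x) = 0" by (rule queue_of_tight_not_queueing_arc[OF tight nq])
    have "slope w x = (1 + (p e (l ?v x) - m e (l ?v x + \<tau> e)) / \<nu> e) * slope ?v x"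
      by (rule right_derivative_cong_frequently[OF slope_deriv exit_deriv[OF e(1)] eq])
        (use w fr in \<open>auto simp: Q_def[abs_def]\<close>)
    moreover have "1 * slope ?v x \<le> (1 + (p e (l ?v x) - m e (l ?v x + \<tau> e)) / \<nu> e) * slope ?v x"
      using outflow_le_inflow_of_empty_queue[OF e(1) z0] service_rate_pos[OF e(1)]
      by (intro mult_right_mono slope_nonneg V) auto
    ultimately show ?thesis by simp
  qed
  ultimately show ?thesis using e(2) by blast
qed

lemma thin_flow_slope:
  "thin_flow (tight_arcs (\<lambda>v. l v x)) (queueing_arcs (\<lambda>v. l v x)) (u x) (\<lambda>v. slope v x) (\<lambda>e. arc_flow e x)"
  unfolding thin_flow_def
proof (intro conjI ballI impI)
  fix e assume e: "e \<in> arcs G"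
  show "0 \<le> arc_flow e x"
    using e by (simp add: arc_flow_def rates_nonneg slope_nonneg)
next
  fix v assume v: "v \<in> verts G - {t}"
  \<comment> \<open>Both sums are rates at the common time \<open>l v x\<close>, multiplied by the
    slope of \<open>l v\<close>: tails for outgoing edges, heads for incoming ones. So conservation
    at that time applies.\<close>
  have "(\<Sum>e\<in>out_arcs G v. arc_flow e x) = (\<Sum>e\<in>out_arcs G v. p e (l v x)) * slope v x"
    unfolding sum_distrib_right by (intro sum.cong) (auto simp: arc_flow_def)
  moreover have "(\<Sum>e\<in>in_arcs G v. arc_flow e x) = (\<Sum>e\<in>in_arcs G v. m e (l v x)) * slope v x"
    unfolding sum_distrib_right by (intro sum.cong) (auto simp: arc_flow_eq_outflow)
  ultimately have "(\<Sum>e\<in>out_arcs G v. arc_flow e x) - (\<Sum>e\<in>in_arcs G v. arc_flow e x)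
      = (if v = s then u (l v x) else 0) * slope v x"
    using conservation[OF v, of "l v x"] by (simp add: left_diff_distrib[symmetric])
  thus "(\<Sum>e\<in>out_arcs G v. arc_flow e x) - (\<Sum>e\<in>in_arcs G v. arc_flow e x) = (if v = s then u x else 0)"
    by (simp add: earliest_time_source slope_source)
qed (simp_all add: slope_source arc_flow_not_tight slope_queueing slope_tight slope_predecessor)

end

section \<open>Uniqueness\<close>

lemma eventually_eq_of_tendsto_finite:
  fixes g :: "real \<Rightarrow> real"
  assumes "(g \<longlongrightarrow> a) F" "finite V" "eventually (\<lambda>x. g x \<in> V) F"
  shows "eventually (\<lambda>x. g x = a) F"
proof -
  have "open (- (V - {a}))" using assms(2) by (intro open_Compl finite_imp_closed) auto
  hence "eventually (\<lambda>x. g x \<in> - (V - {a})) F" by (intro topological_tendstoD[OF assms(1)]) auto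
  with assms(3) show ?thesis by eventually_elim auto
qed

lemma (in flow_network) tight_arcs_subset: "tight_arcs k \<subseteq> arcs G"
  by (auto simp: tight_arcs_def)

lemma (in flow_network) acyclic_tight_arcs:
  "acyclic ((\<lambda>e. (tail G e, head G e)) ` tight_arcs k)"
  by (rule acyclic_of_potential[of _ k]) (auto simp: tight_arcs_def)

context right_continuous_equilibrium
begin

text \<open>On an interval of constant inflow the slopes are determined by the pair of arc sets, hence
  take finitely many values; a right-continuous function with finitely many values is locally
  constant to the right.\<close>

lemma slope_locally_constant:
  assumes w: "w \<in> verts G" and u: "eventually (\<lambda>x. u x = u \<phi>) (at_right \<phi>)"
  shows "eventually (\<lambda>x. slope w x = slope w \<phi>) (at_right \<phi>)"
proof -
  \<comment> \<open>One thin flow is chosen per pair of edge sets, independently of the time;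
    uniqueness makes it agree with the slopes at \<open>w\<close>.\<close>
  define F where "F AB = (SOME d. \<exists>y. thin_flow (fst AB) (snd AB) (u \<phi>) d y) w" for AB
  have "slope w x \<in> F ` (Pow (arcs G) \<times> Pow (arcs G))" if "u x = u \<phi>" for x
  proof -
    let ?A = "tight_arcs (\<lambda>v. l v x)" and ?B = "queueing_arcs (\<lambda>v. l v x)"
    have thin: "thin_flow ?A ?B (u \<phi>) (\<lambda>v. slope v x) (\<lambda>e. arc_flow e x)"
      using thin_flow_slope[of x] that by simp
    hence "\<exists>d y. thin_flow ?A ?B (u \<phi>) d y" by blast
    from someI_ex[OF this] obtain y where
      "thin_flow ?A ?B (u \<phi>) (SOME d. \<exists>y. thin_flow ?A ?B (u \<phi>) d y) y" by blast
    hence "slope w x = F (?A, ?B)"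
      unfolding F_def fst_conv snd_conv
      by (rule thin_flow_unique[OF thin]) (simp_all add: acyclic_tight_arcs tight_arcs_subset w)
    moreover have "?A \<in> Pow (arcs G)" "?B \<in> Pow (arcs G)"
      by (auto simp: tight_arcs_def queueing_arcs_def)
    ultimately show ?thesis by blast
  qed
  with u have "eventually (\<lambda>x. slope w x \<in> F ` (Pow (arcs G) \<times> Pow (arcs G))) (at_right \<phi>)"
    by (auto elim: eventually_mono)
  moreover have "(slope w \<longlongrightarrow> slope w \<phi>) (at_right \<phi>)"
    using slope_smooth[OF w] by (simp add: right_smooth_def continuous_within)
  ultimately show ?thesis by (intro eventually_eq_of_tendsto_finite) auto
qed

lemma earliest_time_locally_affine:
  assumes w: "w \<in> verts G" and u: "eventually (\<lambda>x. u x = u \<phi>) (at_right \<phi>)"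
  shows "eventually (\<lambda>x. l w x = l w \<phi> + slope w \<phi> * (x - \<phi>)) (at_right \<phi>)"
proof -
  obtain b where b: "\<phi> < b" "\<And>x. \<phi> < x \<Longrightarrow> x < b \<Longrightarrow> slope w x = slope w \<phi>"
    using slope_locally_constant[OF assms] unfolding eventually_at_right_field by blast
  have "l w x - l w \<phi> = slope w \<phi> * (x - \<phi>)" if "\<phi> < x" "x < b" for x
  proof (rule right_smooth_increment_eq[OF slope_smooth[OF w]])
    fix y assume "\<phi> \<le> y" "y < x"
    thus "slope w y = slope w \<phi>" using b(2)[of y] that by (cases "y = \<phi>") auto
  qed (use that in simp)
  thus ?thesis unfolding eventually_at_right_field using b(1) by (intro exI[of _ b]) fastforce
qed

end

lemma piecewise_constant_inflow_eventually_eq: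
  assumes "piecewise_constant_inflow u"
  shows "eventually (\<lambda>y. u y = u x) (at_right x)"
proof (cases "x < 0")
  case True
  thus ?thesis using assms unfolding eventually_at_right_field piecewise_constant_inflow_def
    by (intro exI[of _ 0]) auto
next
  case False
  obtain \<xi> :: "nat \<Rightarrow> real" where \<xi>: "\<xi> 0 = 0" "filterlim \<xi> at_top sequentially"
    "\<And>k. u constant_on {\<xi> k..<\<xi> (Suc k)}"
    using assms by (auto simp: piecewise_constant_inflow_def)
  have "\<exists>n. x < \<xi> n"
    using \<xi>(2) unfolding filterlim_at_top_dense eventually_sequentially by blast
  \<comment> \<open>The first breakpoint after \<open>x\<close>; the preceding one exists because
    \<open>\<xi> 0 = 0 \<le> x\<close>.\<close>
  define n where "n = (LEAST n. x < \<xi> n)"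
  have n: "x < \<xi> n" unfolding n_def using \<open>\<exists>n. x < \<xi> n\<close> by (rule LeastI_ex)
  have "n \<noteq> 0" using n False \<xi>(1) by (metis)
  then obtain k where k: "n = Suc k" by (cases n) auto
  have "\<not> x < \<xi> k" using not_less_Least[of k "\<lambda>n. x < \<xi> n"] k by (simp add: n_def)
  hence "u y = u x" if "x < y" "y < \<xi> n" for y
    using \<xi>(3)[of k] that n by (auto simp: constant_on_def k)
  thus ?thesis unfolding eventually_at_right_field using n by blast
qed

theorem theorem12:
  fixes G :: "('v, 'e) pre_digraph" and \<nu> \<tau> :: "'e \<Rightarrow> real" and s t :: 'v
    and u :: "real \<Rightarrow> real" and f g :: "'e flow"
  assumes "flow_network G \<nu> \<tau> s t"
    and "u \<in> F0"
    and "piecewise_constant_inflow u"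
    and "flow_network.dynamic_equilibrium G \<nu> \<tau> s t u f"
    and "flow_network.right_continuous_flow G f"
    and "flow_network.dynamic_equilibrium G \<nu> \<tau> s t u g"
    and "flow_network.right_continuous_flow G g"
  shows "\<forall>v\<in>verts G. flow_network.earliest_time G \<nu> \<tau> s f v
                     = flow_network.earliest_time G \<nu> \<tau> s g v"
proof -
  interpret flow_network G \<nu> \<tau> s t by (rule assms(1))
  have u: "eventually (\<lambda>y. u y = u x) (at_right x)" for x
    by (rule piecewise_constant_inflow_eventually_eq[OF assms(3)])
  have urc: "continuous (at_right x) u" for x
    unfolding continuous_within by (rule tendsto_eventually[OF u])
  interpret f: right_continuous_equilibrium G \<nu> \<tau> s t u f
    by unfold_locales (use assms(4,5) urc in auto)
  interpret g: right_continuous_equilibrium G \<nu> \<tau> s t u g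
    by unfold_locales (use assms(6,7) urc in auto)
  let ?f = "earliest_time f" and ?g = "earliest_time g"
  define E where "E = (\<Inter>w\<in>verts G. {x. ?f w x = ?g w x})"
  have "closed E"
    unfolding E_def using f.slope_smooth g.slope_smooth
    by (intro closed_INT ballI closed_Collect_eq) (auto simp: right_smooth_def)
  \<comment> \<open>Agreement is required on whole initial half-lines, so that it holds everywhere
    below \<open>Sup S\<close>; closedness of \<open>E\<close> adds \<open>Sup S\<close>
    itself.\<close>
  define S where "S = {y. {..y} \<subseteq> E}"
  have extend: "\<exists>y>\<phi>. y \<in> S" if \<phi>: "{..\<phi>} \<subseteq> E" for \<phi>
  proof -
    have eq: "?f w \<phi> = ?g w \<phi>" if "w \<in> verts G" for w using \<phi> that by (auto simp: E_def)
    have sets: "tight_arcs (\<lambda>v. ?f v \<phi>) = tight_arcs (\<lambda>v. ?g v \<phi>)"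
      "queueing_arcs (\<lambda>v. ?f v \<phi>) = queueing_arcs (\<lambda>v. ?g v \<phi>)"
      using eq by (auto simp: tight_arcs_def queueing_arcs_def)
    have slope: "f.slope w \<phi> = g.slope w \<phi>" if "w \<in> verts G" for w
      by (rule thin_flow_unique[OF f.thin_flow_slope[of \<phi>, unfolded sets] g.thin_flow_slope[of \<phi>]])
        (simp_all add: acyclic_tight_arcs tight_arcs_subset that)
    have "\<forall>w\<in>verts G. eventually (\<lambda>x. ?f w x = ?g w x) (at_right \<phi>)"
    proof
      fix w assume w: "w \<in> verts G"
      show "eventually (\<lambda>x. ?f w x = ?g w x) (at_right \<phi>)"
        using f.earliest_time_locally_affine[OF w u] g.earliest_time_locally_affine[OF w u]
        by eventually_elim (simp add: eq[OF w] slope[OF w])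
    qed
    hence "eventually (\<lambda>x. \<forall>w\<in>verts G. ?f w x = ?g w x) (at_right \<phi>)"
      by (intro eventually_ball_finite) auto
    then obtain b where b: "\<phi> < b" "\<And>x. \<phi> < x \<Longrightarrow> x < b \<Longrightarrow> x \<in> E"
      unfolding eventually_at_right_field by (auto simp: E_def)
    \<comment> \<open>The midpoint is used because agreement at \<open>b\<close> itself has not been
      established.\<close>
    have "x \<in> E" if "x \<le> (\<phi> + b) / 2" for x
      using that \<phi> b by (cases "x \<le> \<phi>") auto
    hence "(\<phi> + b) / 2 \<in> S" by (auto simp: S_def)
    thus ?thesis using b(1) by (intro exI[of _ "(\<phi> + b) / 2"]) auto
  qed
  have start: "- sum \<tau> (arcs G) \<in> S"
    by (auto simp: S_def E_def f.earliest_time_early g.earliest_time_early)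
  have "E = UNIV"
  proof (rule ccontr)
    assume "E \<noteq> UNIV"
    then obtain x0 where "x0 \<notin> E" by blast
    have bdd: "bdd_above S"
    proof (rule bdd_aboveI)
      fix y assume "y \<in> S"
      with \<open>x0 \<notin> E\<close> have "\<not> x0 \<le> y" by (auto simp: S_def)
      thus "y \<le> x0" by simp
    qed
    have "S \<subseteq> E" by (auto simp: S_def)
    hence "Sup S \<in> E"
      using closure_contains_Sup[of S] closure_minimal[OF _ \<open>closed E\<close>] start bdd by blast
    moreover have "x \<in> E" if x: "x < Sup S" for x
    proof -
      obtain y where "y \<in> S" "x < y" using less_cSup_iff[of S x] start bdd x by blast
      thus ?thesis by (auto simp: S_def)
    qed
    ultimately have "{..Sup S} \<subseteq> E" by (auto simp: le_less)
    then obtain y where "Sup S < y" "y \<in> S" using extend by blast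
    thus False using cSup_upper[OF _ bdd] by force
  qed
  thus ?thesis by (auto simp: E_def fun_eq_iff)
qed

end
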